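(* Let $M\times_\lambda N$ be the singly warped product of Riemannian manifolds $(M,g)$ and $(N,h)$, $n=\dim N$, with smooth warping function $\lambda:M\to(0,+\infty)$; let $x_0\in M$ and let $f:(N,h)\to(0,+\infty)$ be a smooth function. The inclusion map $i_{x_0}:(N,h)\to M\times_\lambda N$, $i_{x_0}(y)=(x_0,y)$, is an $f$-bi-harmonic map if and only if $\lambda$ and $f$ satisfy, at $x_0$ and for all $y\in N$, $$\begin{cases}n f(y)\,\mathrm{grad}_g\big(|\mathrm{grad}_g\lambda^2|^2\big)-8(\Delta_Nf(y))\,\mathrm{grad}_g\lambda^2=0,\\[2pt]|\mathrm{grad}_g\lambda|^2\,\mathrm{grad}_hf(y)=0.\end{cases}$$
   Context: $M\times_\lambda N$ is $M\times N$ with the metric $\bar g=g\oplus\lambda^2h$; $\Delta_N=\mathrm{div}\,\mathrm{grad}$ on $(N,h)$. Curvature convention: $R(X,Y)Z=\nabla_X\nabla_YZ-\nabla_Y\nabla_XZ-\nabla_{[X,Y]}Z$. For a smooth map $\phi:(N,h)\to(P,k)$ and a positive smooth function $f$ on $N$, $\tau(\phi)=\mathrm{Tr}_h\nabla d\phi$; $\phi$ is $f$-bi-harmonic if it is a critical point of $E_{2,f}(\phi)=\frac12\int_\Omega f|\tau(\phi)|^2dv_h$ for every compact domain $\Omega\subset N$; equivalently $\tau_{2,f}(\phi)=-\mathrm{Tr}_h(\nabla^\phi)^2(f\tau(\phi))-f\sum_\alpha R^P(\tau(\phi),d\phi(\bar e_\alpha))d\phi(\bar e_\alpha)=0$, where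 $\nabla^\phi$ is the pull-back connection, $\{\bar e_\alpha\}$ a local orthonormal frame of $N$, and $\mathrm{Tr}_h(\nabla^\phi)^2V=\sum_\alpha(\nabla^\phi_{\bar e_\alpha}\nabla^\phi_{\bar e_\alpha}V-\nabla^\phi_{\nabla_{\bar e_\alpha}\bar e_\alpha}V)$. *)

theory Defs
  imports "HOL-Analysis.Analysis"
begin

section \<open>Smooth functions on open sets of normed spaces\<close>

text \<open>Intended for open \<open>S\<close> only.\<close>

primrec Ck_on :: "nat \<Rightarrow> 'a::real_normed_vector set \<Rightarrow> ('a \<Rightarrow> 'b::real_normed_vector) \<Rightarrow> bool" where
  "Ck_on 0 S F \<longleftrightarrow> continuous_on S F"
| "Ck_on (Suc k) S F \<longleftrightarrow>
     (\<forall>x\<in>S. F differentiable (at x)) \<and> (\<forall>v. Ck_on k S (\<lambda>x. frechet_derivative F (at x) v))"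

definition smooth_on :: "'a::real_normed_vector set \<Rightarrow> ('a \<Rightarrow> 'b::real_normed_vector) \<Rightarrow> bool" where
  "smooth_on S F \<longleftrightarrow> (\<forall>k. Ck_on k S F)"


section \<open>Riemannian manifolds\<close>

text \<open>
  The underlying space is a whole type \<open>'m\<close> (Hausdorff and second countable), the model space is
  a Euclidean space \<open>'e\<close>, so the dimension is \<open>DIM('e)\<close>. The atlas is a family of charts indexed by
  a type \<open>'i\<close>; repetitions are harmless, so every nonempty atlas is of this form.

  A tangent vector at \<open>p\<close> is given by its components \<open>u :: 'e\<close> in a chart \<open>i\<close> around \<open>p\<close>. In
  particular \<open>metric M i p u v\<close> is \<open>g\<^sub>p(X, Y)\<close> for the tangent vectors \<open>X\<close>, \<open>Y\<close> having
  components \<open>u\<close>, \<open>v\<close> in chart \<open>i\<close>. Likewise a vector field on the domain of the chart \<open>i\<close> is a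
  function \<open>'m \<Rightarrow> 'e\<close>, and a vector field along a map \<open>\<phi>\<close> into \<open>P\<close> is, over the preimage of the
  domain of a chart \<open>j\<close> of \<open>P\<close>, a function from the source of \<open>\<phi>\<close> to the model space of \<open>P\<close>.
\<close>

record ('i, 'm, 'e) riem =
  chart_dom :: "'i \<Rightarrow> 'm set"
  coord     :: "'i \<Rightarrow> 'm \<Rightarrow> 'e"
  metric    :: "'i \<Rightarrow> 'm \<Rightarrow> 'e \<Rightarrow> 'e \<Rightarrow> real"

definition chart_inv :: "('i, 'm, 'e) riem \<Rightarrow> 'i \<Rightarrow> 'e \<Rightarrow> 'm" where
  "chart_inv M i = inv_into (chart_dom M i) (coord M i)"

definition smooth_manifold ::
  "('i, 'm::{t2_space,second_countable_topology}, 'e::euclidean_space) riem \<Rightarrow> bool" where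
  "smooth_manifold M \<longleftrightarrow>
     (\<Union>i. chart_dom M i) = UNIV \<and>
     (\<forall>i. open (chart_dom M i) \<and> open (coord M i ` chart_dom M i) \<and>
          homeomorphism (chart_dom M i) (coord M i ` chart_dom M i) (coord M i) (chart_inv M i)) \<and>
     (\<forall>i j. smooth_on (coord M i ` (chart_dom M i \<inter> chart_dom M j)) (coord M j \<circ> chart_inv M i))"

text \<open>\<open>dirderiv M i F p u\<close> is the derivative at \<open>p\<close> of the vector-valued function \<open>F\<close>, defined
  near \<open>p\<close>, along the tangent vector with components \<open>u\<close> in chart \<open>i\<close>.\<close>

definition dirderiv ::
  "('i, 'm, 'e::euclidean_space) riem \<Rightarrow> 'i \<Rightarrow> ('m \<Rightarrow> 'b::real_normed_vector) \<Rightarrow> 'm \<Rightarrow> 'e \<Rightarrow> 'b" where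
  "dirderiv M i F p u = frechet_derivative (F \<circ> chart_inv M i) (at (coord M i p)) u"

definition riemannian_manifold ::
  "('i, 'm::{t2_space,second_countable_topology}, 'e::euclidean_space) riem \<Rightarrow> bool" where
  "riemannian_manifold M \<longleftrightarrow>
     smooth_manifold M \<and>
     (\<forall>i. \<forall>p\<in>chart_dom M i.
        bilinear (metric M i p) \<and>
        (\<forall>u v. metric M i p u v = metric M i p v u) \<and>
        (\<forall>u. u \<noteq> 0 \<longrightarrow> metric M i p u u > 0)) \<and>
     (\<forall>i u v. smooth_on (coord M i ` chart_dom M i) (\<lambda>x. metric M i (chart_inv M i x) u v)) \<and>
     (\<forall>i j. \<forall>p\<in>chart_dom M i \<inter> chart_dom M j. \<forall>u v.
        metric M i p u v
          = metric M j p (dirderiv M i (coord M j) p u) (dirderiv M i (coord M j) p v))"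

definition smooth_fun ::
  "('i, 'm, 'e::euclidean_space) riem \<Rightarrow> ('m \<Rightarrow> real) \<Rightarrow> bool" where
  "smooth_fun M F \<longleftrightarrow> (\<forall>i. smooth_on (coord M i ` chart_dom M i) (F \<circ> chart_inv M i))"

definition smooth_map ::
  "('j, 'n::topological_space, 'a::euclidean_space) riem \<Rightarrow>
   ('k, 'p::topological_space, 'b::euclidean_space) riem \<Rightarrow> ('n \<Rightarrow> 'p) \<Rightarrow> bool" where
  "smooth_map N P \<phi> \<longleftrightarrow>
     continuous_on UNIV \<phi> \<and>
     (\<forall>j k. smooth_on (coord N j ` (chart_dom N j \<inter> \<phi> -` chart_dom P k))
                      (coord P k \<circ> \<phi> \<circ> chart_inv N j))"


section \<open>Gradient, Levi-Civita connection, curvature, Laplacian\<close>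

definition riesz :: "('e \<Rightarrow> 'e \<Rightarrow> real) \<Rightarrow> ('e \<Rightarrow> real) \<Rightarrow> 'e" where
  "riesz q \<alpha> = (THE w. \<forall>z. q w z = \<alpha> z)"

text \<open>The trace of a bilinear form \<open>B\<close> with respect to the inner product \<open>q\<close>, that is
  the sum of \<open>q\<^sup>a\<^sup>b B\<^sub>a\<^sub>b\<close>, where the vector \<open>q\<^sup>a\<^sup>b e\<^sub>a\<close> is the one dual to the linear form
  \<open>z \<mapsto> z \<bullet> e\<^sub>b\<close>. By the lemma \<open>trace_orthonormal\<close> below, it is the sum of \<open>B (e\<^sub>\<alpha>) (e\<^sub>\<alpha>)\<close> over
  an arbitrary \<open>q\<close>-orthonormal basis.\<close>

definition metric_trace ::
  "('e::euclidean_space \<Rightarrow> 'e \<Rightarrow> real) \<Rightarrow> ('e \<Rightarrow> 'e \<Rightarrow> 'b::real_vector) \<Rightarrow> 'b" where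
  "metric_trace q B = (\<Sum>b\<in>Basis. B (riesz q (\<lambda>z. z \<bullet> b)) b)"

definition grad :: "('i, 'm, 'e::euclidean_space) riem \<Rightarrow> 'i \<Rightarrow> ('m \<Rightarrow> real) \<Rightarrow> 'm \<Rightarrow> 'e" where
  "grad M i F p = riesz (metric M i p) (dirderiv M i F p)"

definition sqnorm :: "('i, 'm, 'e) riem \<Rightarrow> 'i \<Rightarrow> 'm \<Rightarrow> 'e \<Rightarrow> real" where
  "sqnorm M i p u = metric M i p u u"

text \<open>Koszul formula for the coordinate vector fields of chart \<open>i\<close>, whose brackets vanish.\<close>

definition christoffel :: "('i, 'm, 'e::euclidean_space) riem \<Rightarrow> 'i \<Rightarrow> 'm \<Rightarrow> 'e \<Rightarrow> 'e \<Rightarrow> 'e" where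
  "christoffel M i p u v = riesz (metric M i p) (\<lambda>z.
     (dirderiv M i (\<lambda>q. metric M i q v z) p u
      + dirderiv M i (\<lambda>q. metric M i q u z) p v
      - dirderiv M i (\<lambda>q. metric M i q u v) p z) / 2)"

definition nabla ::
  "('i, 'm, 'e::euclidean_space) riem \<Rightarrow> 'i \<Rightarrow> ('m \<Rightarrow> 'e) \<Rightarrow> ('m \<Rightarrow> 'e) \<Rightarrow> 'm \<Rightarrow> 'e" where
  "nabla M i X Y p = dirderiv M i Y p (X p) + christoffel M i p (X p) (Y p)"

definition lie_bracket ::
  "('i, 'm, 'e::euclidean_space) riem \<Rightarrow> 'i \<Rightarrow> ('m \<Rightarrow> 'e) \<Rightarrow> ('m \<Rightarrow> 'e) \<Rightarrow> 'm \<Rightarrow> 'e" where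
  "lie_bracket M i X Y p = dirderiv M i Y p (X p) - dirderiv M i X p (Y p)"

definition curvature_field ::
  "('i, 'm, 'e::euclidean_space) riem \<Rightarrow> 'i \<Rightarrow> ('m \<Rightarrow> 'e) \<Rightarrow> ('m \<Rightarrow> 'e) \<Rightarrow> ('m \<Rightarrow> 'e) \<Rightarrow> 'm \<Rightarrow> 'e" where
  "curvature_field M i X Y Z p =
     nabla M i X (nabla M i Y Z) p - nabla M i Y (nabla M i X Z) p
       - nabla M i (lie_bracket M i X Y) Z p"

text \<open>The value of a tensor on vectors at a point is computed by extending the vectors to fields
  with constant components in the chart; the same is done for the second fundamental form and the
  second covariant derivative below.\<close>

definition curvature ::
  "('i, 'm, 'e::euclidean_space) riem \<Rightarrow> 'i \<Rightarrow> 'm \<Rightarrow> 'e \<Rightarrow> 'e \<Rightarrow> 'e \<Rightarrow> 'e" where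
  "curvature M i p u v w = curvature_field M i (\<lambda>_. u) (\<lambda>_. v) (\<lambda>_. w) p"

text \<open>Trace of the endomorphism \<open>v \<mapsto> \<nabla>\<^sub>v X\<close>.\<close>

definition divergence :: "('i, 'm, 'e::euclidean_space) riem \<Rightarrow> 'i \<Rightarrow> ('m \<Rightarrow> 'e) \<Rightarrow> 'm \<Rightarrow> real" where
  "divergence M i X p = (\<Sum>b\<in>Basis. nabla M i (\<lambda>_. b) X p \<bullet> b)"

definition laplacian :: "('i, 'm, 'e::euclidean_space) riem \<Rightarrow> 'i \<Rightarrow> ('m \<Rightarrow> real) \<Rightarrow> 'm \<Rightarrow> real" where
  "laplacian M i F = divergence M i (grad M i F)"


section \<open>Maps between Riemannian manifolds\<close>

text \<open>Throughout, \<open>j\<close> is a chart of the source \<open>N\<close> and \<open>k\<close> is a chart of the target \<open>P\<close>.\<close>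

definition differential ::
  "('j, 'n, 'a::euclidean_space) riem \<Rightarrow> ('k, 'p, 'b::euclidean_space) riem \<Rightarrow>
   'j \<Rightarrow> 'k \<Rightarrow> ('n \<Rightarrow> 'p) \<Rightarrow> 'n \<Rightarrow> 'a \<Rightarrow> 'b" where
  "differential N P j k \<phi> p u = dirderiv N j (coord P k \<circ> \<phi>) p u"

text \<open>\<open>\<nabla>\<^sup>\<phi>\<^sub>X V\<close> for the pull-back connection and a vector field \<open>V\<close> along \<open>\<phi>\<close>.\<close>

definition pullback_nabla ::
  "('j, 'n, 'a::euclidean_space) riem \<Rightarrow> ('k, 'p, 'b::euclidean_space) riem \<Rightarrow>
   'j \<Rightarrow> 'k \<Rightarrow> ('n \<Rightarrow> 'p) \<Rightarrow> ('n \<Rightarrow> 'a) \<Rightarrow> ('n \<Rightarrow> 'b) \<Rightarrow> 'n \<Rightarrow> 'b" where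
  "pullback_nabla N P j k \<phi> X V p =
     dirderiv N j V p (X p)
       + christoffel P k (\<phi> p) (differential N P j k \<phi> p (X p)) (V p)"

text \<open>\<open>(\<nabla>d\<phi>)(X, Y)\<close>\<close>

definition second_fundamental_form ::
  "('j, 'n, 'a::euclidean_space) riem \<Rightarrow> ('k, 'p, 'b::euclidean_space) riem \<Rightarrow>
   'j \<Rightarrow> 'k \<Rightarrow> ('n \<Rightarrow> 'p) \<Rightarrow> ('n \<Rightarrow> 'a) \<Rightarrow> ('n \<Rightarrow> 'a) \<Rightarrow> 'n \<Rightarrow> 'b" where
  "second_fundamental_form N P j k \<phi> X Y p =
     pullback_nabla N P j k \<phi> X (\<lambda>q. differential N P j k \<phi> q (Y q)) p
       - differential N P j k \<phi> p (nabla N j X Y p)"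

definition tension ::
  "('j, 'n, 'a::euclidean_space) riem \<Rightarrow> ('k, 'p, 'b::euclidean_space) riem \<Rightarrow>
   'j \<Rightarrow> 'k \<Rightarrow> ('n \<Rightarrow> 'p) \<Rightarrow> 'n \<Rightarrow> 'b" where
  "tension N P j k \<phi> p =
     metric_trace (metric N j p)
       (\<lambda>u v. second_fundamental_form N P j k \<phi> (\<lambda>_. u) (\<lambda>_. v) p)"

text \<open>\<open>\<nabla>\<^sup>\<phi>\<^sub>X \<nabla>\<^sup>\<phi>\<^sub>Y V - \<nabla>\<^sup>\<phi>\<^bsub>\<nabla>\<^sub>X Y\<^esub> V\<close>\<close>

definition second_covariant_derivative ::
  "('j, 'n, 'a::euclidean_space) riem \<Rightarrow> ('k, 'p, 'b::euclidean_space) riem \<Rightarrow>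
   'j \<Rightarrow> 'k \<Rightarrow> ('n \<Rightarrow> 'p) \<Rightarrow> ('n \<Rightarrow> 'a) \<Rightarrow> ('n \<Rightarrow> 'a) \<Rightarrow> ('n \<Rightarrow> 'b) \<Rightarrow> 'n \<Rightarrow> 'b" where
  "second_covariant_derivative N P j k \<phi> X Y V p =
     pullback_nabla N P j k \<phi> X (pullback_nabla N P j k \<phi> Y V) p
       - pullback_nabla N P j k \<phi> (nabla N j X Y) V p"

definition f_bitension ::
  "('j, 'n, 'a::euclidean_space) riem \<Rightarrow> ('k, 'p, 'b::euclidean_space) riem \<Rightarrow>
   'j \<Rightarrow> 'k \<Rightarrow> ('n \<Rightarrow> real) \<Rightarrow> ('n \<Rightarrow> 'p) \<Rightarrow> 'n \<Rightarrow> 'b" where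
  "f_bitension N P j k f \<phi> p =
     - metric_trace (metric N j p)
         (\<lambda>u v. second_covariant_derivative N P j k \<phi> (\<lambda>_. u) (\<lambda>_. v)
                  (\<lambda>q. f q *\<^sub>R tension N P j k \<phi> q) p)
     - f p *\<^sub>R metric_trace (metric N j p)
         (\<lambda>u v. curvature P k (\<phi> p) (tension N P j k \<phi> p)
                  (differential N P j k \<phi> p u) (differential N P j k \<phi> p v))"

text \<open>\<open>f\<close>-bi-harmonicity is stated as the Euler-Lagrange equation \<open>\<tau>\<^bsub>2,f\<^esub>(\<phi>) = 0\<close> of the
  functional \<open>E\<^bsub>2,f\<^esub>\<close>; a tangent vector vanishes iff its components vanish in every chart.\<close>

definition f_biharmonic ::
  "('j, 'n::topological_space, 'a::euclidean_space) riem \<Rightarrow>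
   ('k, 'p::topological_space, 'b::euclidean_space) riem \<Rightarrow>
   ('n \<Rightarrow> real) \<Rightarrow> ('n \<Rightarrow> 'p) \<Rightarrow> bool" where
  "f_biharmonic N P f \<phi> \<longleftrightarrow>
     smooth_map N P \<phi> \<and>
     (\<forall>j k. \<forall>p\<in>chart_dom N j. \<phi> p \<in> chart_dom P k \<longrightarrow> f_bitension N P j k f \<phi> p = 0)"


section \<open>Warped products\<close>

definition warped_product ::
  "('i, 'm, 'e) riem \<Rightarrow> ('m \<Rightarrow> real) \<Rightarrow> ('j, 'n, 'a) riem \<Rightarrow> ('i \<times> 'j, 'm \<times> 'n, 'e \<times> 'a) riem" where
  "warped_product M lam N =
     \<lparr> chart_dom = (\<lambda>(i, j). chart_dom M i \<times> chart_dom N j),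
       coord = (\<lambda>(i, j) (x, y). (coord M i x, coord N j y)),
       metric = (\<lambda>(i, j) (x, y) (u, v) (u', v').
          metric M i x u u' + (lam x)\<^sup>2 * metric N j y v v') \<rparr>"


section \<open>The trace in terms of orthonormal bases\<close>

lemma riesz_eqI:
  fixes q :: "'e::real_vector \<Rightarrow> 'e \<Rightarrow> real"
  assumes bil: "bilinear q" and pos: "\<And>u. u \<noteq> 0 \<Longrightarrow> q u u > 0" and w: "\<And>z. q w z = \<alpha> z"
  shows "riesz q \<alpha> = w"
  unfolding riesz_def
proof (rule the_equality)
  show "\<forall>z. q w z = \<alpha> z" using w by blast
next
  fix w' assume "\<forall>z. q w' z = \<alpha> z"
  then have "q (w' - w) (w' - w) = 0" using w by (simp add: bilinear_lsub[OF bil])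
  then show "w' = w" using pos[of "w' - w"] by fastforce
qed

lemma trace_orthonormal:
  fixes q :: "'e::euclidean_space \<Rightarrow> 'e \<Rightarrow> real" and B :: "'e \<Rightarrow> 'e \<Rightarrow> 'b::real_vector"
    and E :: "'e \<Rightarrow> 'e"
  assumes bil: "bilinear q" and pos: "\<And>u. u \<noteq> 0 \<Longrightarrow> q u u > 0"
    and E: "\<And>a b. a \<in> Basis \<Longrightarrow> b \<in> Basis \<Longrightarrow> q (E a) (E b) = (if a = b then 1 else 0)"
    and B: "\<And>v. linear (\<lambda>u. B u v)" "\<And>u. linear (B u)"
  shows "metric_trace q B = (\<Sum>a\<in>Basis. B (E a) (E a))"
proof -
  have lq: "linear (\<lambda>x. q x y)" "linear (q x)" for x y
    using bil by (auto simp: bilinear_def)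
  have qs: "q (\<Sum>a\<in>Basis. c a *\<^sub>R E a) (E b) = c b" if "b \<in> Basis" for c b
  proof -
    have "q (\<Sum>a\<in>Basis. c a *\<^sub>R E a) (E b) = (\<Sum>a\<in>Basis. c a * q (E a) (E b))"
      by (simp add: linear_sum[OF lq(1)] linear_cmul[OF lq(1)])
    also have "\<dots> = (\<Sum>a\<in>Basis. if a = b then c a else 0)"
      by (rule sum.cong) (use that E in auto)
    finally show ?thesis using that by simp
  qed
  define T where "T x = (\<Sum>a\<in>Basis. (x \<bullet> a) *\<^sub>R E a)" for x :: 'e
  have lT: "linear T"
    unfolding T_def by (intro linear_compose_sum ballI linear_scaleR_left linearI)
      (auto simp: inner_add_left scaleR_add_left)
  have "inj T"
  proof (rule linear_injective_0[OF lT, THEN iffD2, rule_format])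
    fix x assume "T x = 0"
    then have "x \<bullet> b = 0" if "b \<in> Basis" for b
      using qs[OF that, of "\<lambda>a. x \<bullet> a"] linear_0[OF lq(1)] by (simp add: T_def)
    then show "x = 0" by (simp add: euclidean_eq_iff[of x 0])
  qed
  then have "surj T" by (rule linear_injective_imp_surjective[OF lT _ refl])
  have expand: "z = (\<Sum>a\<in>Basis. q z (E a) *\<^sub>R E a)" for z
  proof -
    obtain x where x: "z = T x" using \<open>surj T\<close> by (rule surjE)
    have "q z (E a) = x \<bullet> a" if "a \<in> Basis" for a
      unfolding x T_def by (rule qs[OF that])
    then have "(\<Sum>a\<in>Basis. q z (E a) *\<^sub>R E a) = T x"
      unfolding T_def by (intro sum.cong) simp_all
    then show ?thesis using x by simp
  qed
  have dual: "riesz q (\<lambda>z. z \<bullet> b) = (\<Sum>a\<in>Basis. (E a \<bullet> b) *\<^sub>R E a)" for b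
  proof (rule riesz_eqI[OF bil pos])
    fix z
    let ?w = "\<Sum>a\<in>Basis. (E a \<bullet> b) *\<^sub>R E a"
    have "q ?w z = q ?w (\<Sum>c\<in>Basis. q z (E c) *\<^sub>R E c)"
      by (rule arg_cong[OF expand])
    also have "\<dots> = (\<Sum>c\<in>Basis. q z (E c) * q ?w (E c))"
      by (simp only: linear_sum[OF lq(2)] linear_cmul[OF lq(2)] real_scaleR_def)
    also have "\<dots> = (\<Sum>c\<in>Basis. q z (E c) * (E c \<bullet> b))"
      by (rule sum.cong) (simp_all only: qs)
    also have "\<dots> = (\<Sum>c\<in>Basis. q z (E c) *\<^sub>R E c) \<bullet> b"
      by (simp only: inner_sum_left inner_scaleR_left)
    also have "\<dots> = z \<bullet> b"
      by (rule arg_cong[where f = "\<lambda>x. x \<bullet> b", OF expand[symmetric]])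
    finally show "q ?w z = z \<bullet> b" .
  qed
  have "metric_trace q B = (\<Sum>b\<in>Basis. \<Sum>a\<in>Basis. (E a \<bullet> b) *\<^sub>R B (E a) b)"
    unfolding metric_trace_def dual
    by (simp add: linear_sum[OF B(1)] linear_cmul[OF B(1)])
  also have "\<dots> = (\<Sum>a\<in>Basis. \<Sum>b\<in>Basis. (E a \<bullet> b) *\<^sub>R B (E a) b)"
    by (rule sum.swap)
  also have "\<dots> = (\<Sum>a\<in>Basis. B (E a) (\<Sum>b\<in>Basis. (E a \<bullet> b) *\<^sub>R b))"
    by (simp add: linear_sum[OF B(2)] linear_cmul[OF B(2)])
  finally show ?thesis by (simp add: euclidean_representation)
qed

end

(*
  Let G be the gradient of lam^2, A the differential of the change of charts of N, n = dim N and
  mu = - n |G|^2 / (4 lam^2). The tension field of the inclusion is the constant field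
  (- n/2 G(x0), 0), and since nabla_G G = grad |G|^2 / 2, the f-bitension field works out as
  (n/8) (4 (Laplace f) G - n f grad |G|^2) in the M-direction and - 2 mu A (grad f) in the
  N-direction. If G(x0) = 0, then both components and both left-hand sides of the system vanish.
  If G(x0) is nonzero, then so is mu, and each side of the equivalence forces grad f = 0 on N.
  Then Laplace f = 0 and only grad |G|^2 = 0 remains, which is why the factor 4 above is
  compatible with the factor 8 of the system.
*)
theory Submission
  imports Defs
begin

section \<open>Second derivatives and families of bilinear forms\<close>

text \<open>In \<open>f_biharmonic\<close> the chart j of N and the chart (i, j') of the product
  vary independently, so in coordinates the inclusion is a change of charts of N and not the
  identity. Hence the map A of the overview, and hence the transformation law of the Christoffel
  symbols: it rests on the symmetry of second derivatives and removes every second derivative of the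
  change of charts. Gradients and Christoffel symbols are given by \<open>riesz\<close>, a definite
  description. They are differentiated again in nabla_G G and in the curvature, so their
  differentiability has to be drawn from the defining equation of the dual vector. The f-bitension
  field produces the metric trace of \<open>hessian\<close>, whereas the system contains
  \<open>laplacian\<close>, the divergence of the gradient. The two are compared only where each
  contributes zero: if G(x0) = 0 both are multiplied by G(x0), and otherwise grad f = 0 on a whole
  chart domain, where both vanish.\<close>

text \<open>One application of the mean value theorem along \<open>u\<close>, then the derivative \<open>L\<close> of
  \<open>F' _ u\<close> at the single point \<open>x\<close>; no continuity of second derivatives is needed.\<close>

lemma second_difference_quotient:
  fixes F :: "'a::real_normed_vector \<Rightarrow> real"
  assumes S: "open S" "x \<in> S"
    and F: "\<And>y. y \<in> S \<Longrightarrow> (F has_derivative F' y) (at y)"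
    and L: "((\<lambda>y. F' y u) has_derivative L) (at x)"
  shows "((\<lambda>h. (F (x + h *\<^sub>R u + h *\<^sub>R v) - F (x + h *\<^sub>R u) - F (x + h *\<^sub>R v) + F x) / h\<^sup>2)
           \<longlongrightarrow> L v) (at_right 0)"
proof (rule tendstoI)
  fix e :: real assume "e > 0"
  \<comment> \<open>The two expansions below have errors at most
    \<open>e' * h * (norm u + norm v)\<close> and \<open>e' * h * norm u\<close>. Their sum is at
    most \<open>h * e' * c = h * e / 2\<close>; the summand 1 keeps c positive.\<close>
  define c where "c = 2 * norm u + norm v + 1"
  have "c > 0" by (simp add: c_def add_nonneg_pos)
  define e' where "e' = e / (2 * c)"
  have "e' > 0" using \<open>e > 0\<close> \<open>c > 0\<close> by (simp add: e'_def)
  obtain d1 where "d1 > 0" and d1: "\<And>y. norm (y - x) < d1 \<Longrightarrow>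
      norm (F' y u - F' x u - L (y - x)) \<le> e' * norm (y - x)"
    using L \<open>e' > 0\<close> unfolding has_derivative_at_alt by blast
  obtain d2 where "d2 > 0" and d2: "ball x d2 \<subseteq> S"
    using S openE by blast
  define d where "d = min d1 d2 / c"
  have "d > 0" using \<open>d1 > 0\<close> \<open>d2 > 0\<close> \<open>c > 0\<close> by (simp add: d_def)
  interpret L: bounded_linear L using L by (rule has_derivative_bounded_linear)
  show "\<forall>\<^sub>F h in at_right 0. dist
      ((F (x + h *\<^sub>R u + h *\<^sub>R v) - F (x + h *\<^sub>R u) - F (x + h *\<^sub>R v) + F x) / h\<^sup>2) (L v) < e"
    unfolding eventually_at_right_field
  proof (intro exI[of _ d] conjI allI impI \<open>d > 0\<close>)
    fix h :: real assume h: "0 < h" "h < d"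
    have hc: "h * c < min d1 d2" using h \<open>c > 0\<close> by (simp add: d_def pos_less_divide_eq)
    have near: "norm (s *\<^sub>R u + t *\<^sub>R v) \<le> h * (norm u + norm v)"
      "norm (s *\<^sub>R u + t *\<^sub>R v) < min d1 d2"
      if "0 \<le> s" "s \<le> h" "0 \<le> t" "t \<le> h" for s t
    proof -
      have "norm (s *\<^sub>R u + t *\<^sub>R v) \<le> s * norm u + t * norm v"
        using norm_triangle_ineq[of "s *\<^sub>R u" "t *\<^sub>R v"] that by simp
      also have "\<dots> \<le> h * norm u + h * norm v"
        using that by (intro add_mono mult_right_mono) auto
      finally show 1: "norm (s *\<^sub>R u + t *\<^sub>R v) \<le> h * (norm u + norm v)" by (simp add: algebra_simps)
      have "h * (norm u + norm v) \<le> h * c" using h by (simp add: c_def)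
      with 1 hc show "norm (s *\<^sub>R u + t *\<^sub>R v) < min d1 d2" by linarith
    qed
    have inS: "x + s *\<^sub>R u + t *\<^sub>R v \<in> S" if "0 \<le> s" "s \<le> h" "0 \<le> t" "t \<le> h" for s t
    proof -
      have "dist x (x + z) = norm z" for z by (simp add: dist_norm)
      then have "dist x (x + s *\<^sub>R u + t *\<^sub>R v) = norm (s *\<^sub>R u + t *\<^sub>R v)"
        by (simp only: add.assoc)
      then show ?thesis using near(2)[OF that] d2 by auto
    qed
    define \<Phi> where "\<Phi> s = F (x + s *\<^sub>R u + h *\<^sub>R v) - F (x + s *\<^sub>R u)" for s
    have der: "DERIV \<Phi> s :> F' (x + s *\<^sub>R u + h *\<^sub>R v) u - F' (x + s *\<^sub>R u) u"
      if "0 \<le> s" "s \<le> h" for s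
    proof -
      have 1: "((\<lambda>s. F (x + s *\<^sub>R u + t *\<^sub>R v)) has_derivative
          (\<lambda>r. F' (x + s *\<^sub>R u + t *\<^sub>R v) (r *\<^sub>R u))) (at s)" if t: "0 \<le> t" "t \<le> h" for t
      proof -
        have "((\<lambda>s. x + s *\<^sub>R u + t *\<^sub>R v) has_derivative (\<lambda>r. r *\<^sub>R u)) (at s)"
          by (auto intro!: derivative_eq_intros)
        from has_derivative_compose[OF this F[OF inS[OF \<open>0 \<le> s\<close> \<open>s \<le> h\<close> t]]] show ?thesis .
      qed
      have sc: "F' y (r *\<^sub>R u) = r * F' y u" if "y \<in> S" for y r
        using F[OF that, THEN has_derivative_linear] by (simp add: linear_cmul)
      have "(\<Phi> has_derivative (\<lambda>r. r * F' (x + s *\<^sub>R u + h *\<^sub>R v) u - r * F' (x + s *\<^sub>R u) u)) (at s)"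
        unfolding \<Phi>_def
        using has_derivative_diff[OF 1[of h] 1[of 0]] h inS[of s h] inS[of s 0] that
        by (simp only: sc scaleR_zero_left add_0_right order_refl less_imp_le)
      then show ?thesis
        unfolding has_field_derivative_def
        by (rule has_derivative_eq_rhs) (simp add: fun_eq_iff algebra_simps)
    qed
    have "\<exists>z>0. z < h \<and>
        \<Phi> h - \<Phi> 0 = (h - 0) * (F' (x + z *\<^sub>R u + h *\<^sub>R v) u - F' (x + z *\<^sub>R u) u)"
      by (rule MVT2[OF h(1) der])
    then obtain \<xi> where \<xi>: "0 < \<xi>" "\<xi> < h" and
      mv: "\<Phi> h - \<Phi> 0 = h * (F' (x + \<xi> *\<^sub>R u + h *\<^sub>R v) u - F' (x + \<xi> *\<^sub>R u) u)"
      by auto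
    have a1: "norm (F' (x + \<xi> *\<^sub>R u + h *\<^sub>R v) u - F' x u - L (\<xi> *\<^sub>R u + h *\<^sub>R v))
        \<le> e' * (h * (norm u + norm v))"
    proof -
      have "x + \<xi> *\<^sub>R u + h *\<^sub>R v - x = \<xi> *\<^sub>R u + h *\<^sub>R v" by simp
      moreover have "e' * norm (\<xi> *\<^sub>R u + h *\<^sub>R v) \<le> e' * (h * (norm u + norm v))"
        using near(1)[of \<xi> h] \<xi> h \<open>e' > 0\<close> by (intro mult_left_mono) auto
      ultimately show ?thesis
        using d1[of "x + \<xi> *\<^sub>R u + h *\<^sub>R v"] near(2)[of \<xi> h] \<xi> h by simp
    qed
    have a2: "norm (F' (x + \<xi> *\<^sub>R u) u - F' x u - L (\<xi> *\<^sub>R u)) \<le> e' * (h * norm u)"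
    proof -
      have "x + \<xi> *\<^sub>R u - x = \<xi> *\<^sub>R u" by simp
      moreover have "e' * norm (\<xi> *\<^sub>R u) \<le> e' * (h * norm u)"
        using \<xi> \<open>e' > 0\<close> by (intro mult_left_mono) (auto intro: mult_right_mono)
      ultimately show ?thesis
        using d1[of "x + \<xi> *\<^sub>R u"] near(2)[of \<xi> 0] \<xi> h by simp
    qed
    let ?D = "F (x + h *\<^sub>R u + h *\<^sub>R v) - F (x + h *\<^sub>R u) - F (x + h *\<^sub>R v) + F x"
    let ?E = "F' (x + \<xi> *\<^sub>R u + h *\<^sub>R v) u - F' (x + \<xi> *\<^sub>R u) u"
    have D: "?D = h * ?E" using mv by (simp add: \<Phi>_def)
    \<comment> \<open>In the difference of the two first-order expansions at x the unknown term
      \<open>L (\<xi> *\<^sub>R u)\<close> cancels, so the location of \<xi> does not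
      matter.\<close>
    have "L (\<xi> *\<^sub>R u + h *\<^sub>R v) = L (\<xi> *\<^sub>R u) + h * L v"
      by (simp add: L.add L.scaleR)
    then have "\<bar>?E - h * L v\<bar> \<le> e' * (h * (norm u + norm v)) + e' * (h * norm u)"
      using a1 a2 unfolding real_norm_def by linarith
    also have "\<dots> \<le> h * (e' * c)"
      using h \<open>e' > 0\<close> by (simp add: c_def algebra_simps)
    also have "e' * c = e / 2" using \<open>c > 0\<close> by (simp add: e'_def)
    finally have "\<bar>?E - h * L v\<bar> \<le> h * (e / 2)" .
    moreover have "?D / h\<^sup>2 - L v = (?E - h * L v) / h"
      unfolding D using h by (simp add: diff_divide_distrib power2_eq_square)
    ultimately have "\<bar>?D / h\<^sup>2 - L v\<bar> \<le> e / 2"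
      using h by (simp only: abs_divide abs_of_pos pos_divide_le_eq mult.commute)
    then show "dist (?D / h\<^sup>2) (L v) < e"
      using \<open>e > 0\<close> by (simp add: dist_real_def)
  qed
qed

text \<open>The second difference is symmetric in u and v, so both values are limits of one and the
  same quotient.\<close>

lemma second_derivative_symmetric_real:
  fixes F :: "'a::real_normed_vector \<Rightarrow> real"
  assumes "open S" "x \<in> S" "\<And>y. y \<in> S \<Longrightarrow> (F has_derivative F' y) (at y)"
    and "((\<lambda>y. F' y u) has_derivative Lu) (at x)" "((\<lambda>y. F' y v) has_derivative Lv) (at x)"
  shows "Lu v = Lv u"
proof -
  have comm: "x + h *\<^sub>R u + h *\<^sub>R v = x + h *\<^sub>R v + h *\<^sub>R u" for h
    by simp
  have "(\<lambda>h. (F (x + h *\<^sub>R u + h *\<^sub>R v) - F (x + h *\<^sub>R u) - F (x + h *\<^sub>R v) + F x) / h\<^sup>2)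
      = (\<lambda>h. (F (x + h *\<^sub>R v + h *\<^sub>R u) - F (x + h *\<^sub>R v) - F (x + h *\<^sub>R u) + F x) / h\<^sup>2)"
    by (intro ext arg_cong2[where f = "(/)"] refl) (simp add: comm)
  then show ?thesis
    using second_difference_quotient[OF assms(1-4), of v] second_difference_quotient[OF assms(1-3,5), of u]
    by (intro tendsto_unique[OF trivial_limit_at_right_real]) simp_all
qed

lemma second_derivative_symmetric:
  fixes F :: "'a::real_normed_vector \<Rightarrow> 'b::euclidean_space"
  assumes S: "open S" "x \<in> S" and F: "\<And>y. y \<in> S \<Longrightarrow> (F has_derivative F' y) (at y)"
    and L: "((\<lambda>y. F' y u) has_derivative Lu) (at x)" "((\<lambda>y. F' y v) has_derivative Lv) (at x)"
  shows "Lu v = Lv u"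
proof (rule euclidean_eqI)
  fix b :: 'b
  show "Lu v \<bullet> b = Lv u \<bullet> b"
    by (rule second_derivative_symmetric_real[OF S, of "\<lambda>y. F y \<bullet> b" "\<lambda>y h. F' y h \<bullet> b"])
      (intro has_derivative_inner_left F L | assumption)+
qed

section \<open>Basis expansions, product rule for bilinear forms, and dual vectors\<close>

lemma linear_Basis_expansion:
  fixes \<alpha> :: "'e::euclidean_space \<Rightarrow> 'b::real_vector"
  assumes "linear \<alpha>"
  shows "\<alpha> z = (\<Sum>b\<in>Basis. (z \<bullet> b) *\<^sub>R \<alpha> b)"
proof -
  have "\<alpha> z = \<alpha> (\<Sum>b\<in>Basis. (z \<bullet> b) *\<^sub>R b)" by (simp add: euclidean_representation)
  also have "\<dots> = (\<Sum>b\<in>Basis. (z \<bullet> b) *\<^sub>R \<alpha> b)"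
    by (simp add: linear_sum[OF assms] linear_cmul[OF assms])
  finally show ?thesis .
qed

lemma bilinear_Basis_expansion:
  fixes q :: "'e::euclidean_space \<Rightarrow> 'f::euclidean_space \<Rightarrow> real"
  assumes "bilinear q"
  shows "q u v = (\<Sum>a\<in>Basis. \<Sum>b\<in>Basis. (u \<bullet> a) * (v \<bullet> b) * q a b)"
proof -
  have l: "linear (\<lambda>u. q u v)" "linear (q a)" for a v using assms by (simp_all add: bilinear_def)
  have "q u v = (\<Sum>a\<in>Basis. (u \<bullet> a) *\<^sub>R q a v)"
    by (rule linear_Basis_expansion[OF l(1)])
  also have "\<dots> = (\<Sum>a\<in>Basis. (u \<bullet> a) *\<^sub>R (\<Sum>b\<in>Basis. (v \<bullet> b) *\<^sub>R q a b))"
    by (intro sum.cong refl arg_cong[where f = "scaleR _"] linear_Basis_expansion[OF l(2)])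
  finally show ?thesis by (simp add: sum_distrib_left mult.assoc)
qed

text \<open>Differentiability is given only for \<open>q y u v\<close> with fixed u and v. Expansion
  in the standard basis reduces the claim to the product rule for finitely many scalar
  factors.\<close>

lemma has_derivative_bilinear_family:
  fixes q :: "'x::real_normed_vector \<Rightarrow> 'e::euclidean_space \<Rightarrow> 'e \<Rightarrow> real"
  assumes S: "open S" "x \<in> S" and bil: "\<And>y. y \<in> S \<Longrightarrow> bilinear (q y)"
    and Q: "\<And>u v. ((\<lambda>y. q y u v) has_derivative Q u v) (at x)"
    and V: "(V has_derivative V') (at x)" and W: "(W has_derivative W') (at x)"
  shows "((\<lambda>y. q y (V y) (W y)) has_derivative
    (\<lambda>h. Q (V x) (W x) h + q x (V' h) (W x) + q x (V x) (W' h))) (at x)"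
proof -
  have expand: "((\<lambda>y. q y (V y) (W y)) has_derivative (\<lambda>h. \<Sum>a\<in>Basis. \<Sum>b\<in>Basis.
      (V x \<bullet> a) * (W x \<bullet> b) * Q a b h + (V' h \<bullet> a) * (W x \<bullet> b) * q x a b
      + (V x \<bullet> a) * (W' h \<bullet> b) * q x a b)) (at x)"
    if V: "(V has_derivative V') (at x)" and W: "(W has_derivative W') (at x)" for V W V' W'
  proof (rule has_derivative_transform_within_open[OF _ S])
    show "((\<lambda>y. \<Sum>a\<in>Basis. \<Sum>b\<in>Basis. (V y \<bullet> a) * (W y \<bullet> b) * q y a b) has_derivative
      (\<lambda>h. \<Sum>a\<in>Basis. \<Sum>b\<in>Basis.
      (V x \<bullet> a) * (W x \<bullet> b) * Q a b h + (V' h \<bullet> a) * (W x \<bullet> b) * q x a b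
      + (V x \<bullet> a) * (W' h \<bullet> b) * q x a b)) (at x)"
      by (intro has_derivative_sum, rule has_derivative_eq_rhs,
          rule has_derivative_mult[OF has_derivative_mult[OF has_derivative_inner_left[OF V]
            has_derivative_inner_left[OF W]] Q]) (simp add: fun_eq_iff algebra_simps)
    show "(\<Sum>a\<in>Basis. \<Sum>b\<in>Basis. (V y \<bullet> a) * (W y \<bullet> b) * q y a b) = q y (V y) (W y)"
      if "y \<in> S" for y
      by (rule bilinear_Basis_expansion[OF bil[OF that], symmetric])
  qed
  \<comment> \<open>Applied to constant fields, the expansion shows by uniqueness of derivatives
    that Q inherits bilinearity in u and v.\<close>
  have Qe: "Q u v h = (\<Sum>a\<in>Basis. \<Sum>b\<in>Basis. (u \<bullet> a) * (v \<bullet> b) * Q a b h)" for u v h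
    using has_derivative_unique[OF Q[of u v] expand[OF has_derivative_const has_derivative_const]]
    by (simp add: fun_eq_iff)
  show ?thesis
    using expand[OF V W]
    by (simp add: Qe[of "V x" "W x"] bilinear_Basis_expansion[OF bil[OF S(2)], of "V' _"]
        bilinear_Basis_expansion[OF bil[OF S(2)], of "V x"] sum.distrib)
qed

text \<open>Lowering of an index by q, with covectors identified with vectors through the Euclidean
  inner product. It makes \<open>riesz\<close> the inverse of a linear endomorphism.\<close>

definition flat :: "('e::euclidean_space \<Rightarrow> 'e \<Rightarrow> real) \<Rightarrow> 'e \<Rightarrow> 'e" where
  "flat q w = (\<Sum>b\<in>Basis. q w b *\<^sub>R b)"

lemma inner_flat:
  assumes "bilinear q"
  shows "flat q w \<bullet> z = q w z"
proof -
  have "linear (q w)" using assms by (simp add: bilinear_def)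
  then have "q w z = (\<Sum>b\<in>Basis. (z \<bullet> b) * q w b)"
    unfolding real_scaleR_def[symmetric] by (rule linear_Basis_expansion)
  then show ?thesis
    by (simp add: flat_def inner_sum_left inner_commute[of z] mult.commute)
qed

lemma linear_flat: "bilinear q \<Longrightarrow> linear (flat q)"
  by (rule linearI; rule euclidean_eqI)
    (simp_all add: inner_flat inner_add_left bilinear_ladd bilinear_lmul)

lemma inj_flat:
  assumes bil: "bilinear q" and pos: "\<And>u. u \<noteq> 0 \<Longrightarrow> q u u > 0"
  shows "inj (flat q)"
proof (rule linear_injective_0[OF linear_flat[OF bil], THEN iffD2, rule_format])
  fix w assume "flat q w = 0"
  then have "q w w = 0" using inner_flat[OF bil, of w w] by simp
  then show "w = 0" using pos[of w] by fastforce
qed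

text \<open>The existence half of the Riesz representation: \<open>flat q\<close> is injective by
  definiteness, hence surjective by dimension. Uniqueness is \<open>riesz_eqI\<close>.\<close>

lemma riesz_works:
  fixes q :: "'e::euclidean_space \<Rightarrow> 'e \<Rightarrow> real"
  assumes bil: "bilinear q" and pos: "\<And>u. u \<noteq> 0 \<Longrightarrow> q u u > 0" and \<alpha>: "linear \<alpha>"
  shows "q (riesz q \<alpha>) z = \<alpha> z"
proof -
  have "surj (flat q)"
    by (rule linear_injective_imp_surjective[OF linear_flat[OF bil] inj_flat[OF bil pos] refl])
  then obtain w where w: "(\<Sum>b\<in>Basis. \<alpha> b *\<^sub>R b) = flat q w" by (rule surjE)
  have "q w z = \<alpha> z" for z
  proof -
    have "q w z = (\<Sum>b\<in>Basis. \<alpha> b * (b \<bullet> z))"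
      using inner_flat[OF bil, of w z] by (simp add: w[symmetric] inner_sum_left)
    also have "\<dots> = \<alpha> z"
      by (subst linear_Basis_expansion[OF \<alpha>, of z]) (simp add: inner_commute[of z] mult.commute)
    finally show ?thesis .
  qed
  then show ?thesis using riesz_eqI[OF bil pos, of w \<alpha>] by simp
qed

text \<open>Since p vanishes at x, continuity of r is enough: \<open>p y * (r y - r x)\<close> is of
  the order of \<open>norm (y - x)\<close> times a null function, so it has derivative 0. This is
  the step from continuity to differentiability of the dual vector.\<close>

lemma has_derivative_mult_continuous:
  fixes p r :: "'a::real_normed_vector \<Rightarrow> real"
  assumes p: "(p has_derivative p') (at x)" "p x = 0" and r: "isCont r x"
  shows "((\<lambda>y. p y * r y) has_derivative (\<lambda>h. p' h * r x)) (at x)"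
proof -
  have 1: "((\<lambda>y. p y * (r y - r x)) has_derivative (\<lambda>h. 0)) (at x)"
    unfolding has_derivative_at
  proof (intro conjI bounded_linear_zero)
    obtain K where K: "K > 0" "\<And>h. norm (p' h) \<le> norm h * K"
      using bounded_linear.pos_bounded[OF has_derivative_bounded_linear[OF p(1)]] by blast
    obtain d where d: "d > 0" "\<And>y. norm (y - x) < d \<Longrightarrow> norm (p y - p x - p' (y - x)) \<le> 1 * norm (y - x)"
      using p(1) unfolding has_derivative_at_alt by (meson zero_less_one)
    \<comment> \<open>K bounds the linear part and 1 the remainder.\<close>
    have pb: "norm (p (x + h)) \<le> (K + 1) * norm h" if "norm h < d" for h
    proof -
      have "norm (p (x + h) - p' h) \<le> norm h"
        using d(2)[of "x + h"] that p(2) by simp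
      then show ?thesis
        using K(2)[of h] norm_triangle_ineq[of "p (x + h) - p' h" "p' h"]
        by (simp add: algebra_simps)
    qed
    have r0: "((\<lambda>h. (K + 1) * norm (r (x + h) - r x)) \<longlongrightarrow> 0) (at 0)"
    proof -
      have "((\<lambda>h. r (x + h) - r x) \<longlongrightarrow> 0) (at 0)"
        using LIM_zero[OF LIM_offset_zero[OF r[unfolded isCont_def]]] .
      then show ?thesis
        by (intro tendsto_mult_right_zero tendsto_norm_zero)
    qed
    show "((\<lambda>h. norm (p (x + h) * (r (x + h) - r x) - p x * (r x - r x) - 0) / norm h) \<longlongrightarrow> 0) (at 0)"
    proof (rule Lim_null_comparison[OF _ r0])
      show "\<forall>\<^sub>F h in at 0. norm (norm (p (x + h) * (r (x + h) - r x) - p x * (r x - r x) - 0) / norm h)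
          \<le> (K + 1) * norm (r (x + h) - r x)"
        unfolding eventually_at
      proof (intro exI[of _ d] conjI ballI impI d(1))
        fix h :: 'a assume "h \<noteq> 0 \<and> dist h 0 < d"
        then show "norm (norm (p (x + h) * (r (x + h) - r x) - p x * (r x - r x) - 0) / norm h)
          \<le> (K + 1) * norm (r (x + h) - r x)"
          using mult_right_mono[OF pb[of h] norm_ge_zero[of "r (x + h) - r x"]]
          by (simp add: abs_mult pos_divide_le_eq mult_ac)
      qed
    qed
  qed
  have "((\<lambda>y. p y * (r y - r x) + p y * r x) has_derivative (\<lambda>h. 0 + p' h * r x)) (at x)"
    by (intro has_derivative_add 1 has_derivative_mult_left p(1))
  then show ?thesis by (simp add: algebra_simps)
qed

text \<open>The injective map \<open>flat (q x)\<close> is bounded below by some B > 0, and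
  \<open>flat (q y)\<close> differs from it by an operator of norm at most
  \<open>\<delta> y\<close>, which tends to 0. Once \<open>\<delta> y < B / 2\<close>, the dual
  vector is bounded by \<open>2 / B\<close> times its right-hand side.\<close>

lemma riesz_eventually_bounded:
  fixes q :: "'x::t2_space \<Rightarrow> 'e::euclidean_space \<Rightarrow> 'e \<Rightarrow> real"
  assumes S: "open S" "x \<in> S" and bil: "\<And>y. y \<in> S \<Longrightarrow> bilinear (q y)"
    and pos: "\<And>y u. y \<in> S \<Longrightarrow> u \<noteq> 0 \<Longrightarrow> q y u u > 0"
    and lin: "\<And>y. y \<in> S \<Longrightarrow> linear (\<alpha> y)"
    and q: "\<And>u v. isCont (\<lambda>y. q y u v) x" and \<alpha>: "\<And>z. isCont (\<lambda>y. \<alpha> y z) x"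
  shows "\<exists>K. \<forall>\<^sub>F y in at x. norm (riesz (q y) (\<alpha> y)) \<le> K"
proof -
  define w where "w y = riesz (q y) (\<alpha> y)" for y
  define \<beta> where "\<beta> y = (\<Sum>b\<in>Basis. \<alpha> y b *\<^sub>R b)" for y
  define \<delta> where "\<delta> y = (\<Sum>b\<in>Basis. \<Sum>a\<in>Basis. \<bar>q y a b - q x a b\<bar>)" for y
  obtain B where B: "B > 0" "\<And>w. B * norm w \<le> norm (flat (q x) w)"
    using linear_inj_bounded_below_pos[OF linear_flat inj_flat, OF bil bil pos] S(2) by metis
  have flat_w: "flat (q y) (w y) = \<beta> y" if "y \<in> S" for y
    using riesz_works[OF bil pos lin] that by (simp add: flat_def w_def \<beta>_def)
  have diff: "norm (flat (q y) w - flat (q x) w) \<le> \<delta> y * norm w" if y: "y \<in> S" for y w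
  proof -
    have "q y w b - q x w b = (\<Sum>a\<in>Basis. (w \<bullet> a) * (q y a b - q x a b))" for b
      using linear_Basis_expansion[of "\<lambda>w. q y w b" w] linear_Basis_expansion[of "\<lambda>w. q x w b" w]
        bil[OF y] bil[OF S(2)]
      by (simp add: bilinear_def sum_subtractf right_diff_distrib)
    then have "\<bar>q y w b - q x w b\<bar> \<le> (\<Sum>a\<in>Basis. norm w * \<bar>q y a b - q x a b\<bar>)" for b
      by (auto intro!: sum_abs[THEN order_trans] sum_mono mult_right_mono Basis_le_norm simp: abs_mult)
    then have "(\<Sum>b\<in>Basis. \<bar>q y w b - q x w b\<bar>) \<le> \<delta> y * norm w"
      unfolding \<delta>_def sum_distrib_right by (auto intro!: sum_mono simp: mult.commute)
    moreover have "norm (flat (q y) w - flat (q x) w) \<le> (\<Sum>b\<in>Basis. \<bar>q y w b - q x w b\<bar>)"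
      unfolding flat_def sum_subtractf[symmetric] scaleR_diff_left[symmetric]
      by (rule norm_sum[THEN order_trans]) simp
    ultimately show ?thesis by simp
  qed
  have "(\<delta> \<longlongrightarrow> \<delta> x) (at x)"
    unfolding \<delta>_def by (intro tendsto_intros q[unfolded isCont_def])
  moreover have "\<delta> x = 0" by (simp add: \<delta>_def)
  ultimately have "\<forall>\<^sub>F y in at x. \<delta> y < B / 2"
    using B(1) order_tendstoD(2)[of \<delta> "\<delta> x" "at x" "B / 2"] by simp
  moreover have "(\<beta> \<longlongrightarrow> \<beta> x) (at x)"
    unfolding \<beta>_def by (intro tendsto_intros \<alpha>[unfolded isCont_def])
  then have "\<forall>\<^sub>F y in at x. norm (\<beta> y) < norm (\<beta> x) + 1"
    by (rule order_tendstoD(2)[OF tendsto_norm less_add_one])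
  moreover have "\<forall>\<^sub>F y in at x. y \<in> S"
    using S by (simp add: eventually_at_in_open')
  ultimately have "\<forall>\<^sub>F y in at x. norm (w y) \<le> (norm (\<beta> x) + 1) / (B / 2)"
  proof eventually_elim
    case (elim y)
    have "B * norm (w y) \<le> norm (\<beta> y) + \<delta> y * norm (w y)"
      using B(2)[of "w y"] diff[OF elim(3), of "w y"] flat_w[OF elim(3)]
        norm_triangle_ineq2[of "flat (q x) (w y)" "flat (q y) (w y)"]
      by (simp add: norm_minus_commute)
    moreover have "\<delta> y * norm (w y) \<le> B / 2 * norm (w y)"
      using elim(1) by (intro mult_right_mono) auto
    ultimately have "B / 2 * norm (w y) \<le> norm (\<beta> x) + 1"
      using elim(2) by linarith
    then show ?case using B(1) by (simp add: field_simps)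
  qed
  then show ?thesis unfolding w_def by blast
qed

text \<open>Writing \<open>w\<close> for the dual vector, \<open>q x (w y) z = \<alpha> y z - (q y - q x) (w y) z\<close>, where the last
  term is a differentiable factor vanishing at \<open>x\<close> times \<open>w\<close>. So boundedness of \<open>w\<close> gives its
  continuity, and continuity gives differentiability.\<close>

lemma riesz_differentiable:
  fixes q :: "'x::real_normed_vector \<Rightarrow> 'e::euclidean_space \<Rightarrow> 'e \<Rightarrow> real"
  assumes S: "open S" "x \<in> S" and bil: "\<And>y. y \<in> S \<Longrightarrow> bilinear (q y)"
    and pos: "\<And>y u. y \<in> S \<Longrightarrow> u \<noteq> 0 \<Longrightarrow> q y u u > 0"
    and lin: "\<And>y. y \<in> S \<Longrightarrow> linear (\<alpha> y)"
    and q: "\<And>u v. (\<lambda>y. q y u v) differentiable (at x)"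
    and \<alpha>: "\<And>z. (\<lambda>y. \<alpha> y z) differentiable (at x)"
  shows "(\<lambda>y. riesz (q y) (\<alpha> y)) differentiable (at x)"
proof -
  define w where "w y = riesz (q y) (\<alpha> y)" for y
  define e where "e b = riesz (q x) (\<lambda>z. z \<bullet> b)" for b :: 'e
  have qc: "isCont (\<lambda>y. q y u v) x" and \<alpha>c: "isCont (\<lambda>y. \<alpha> y z) x" for u v z
    using q \<alpha> differentiable_imp_continuous_within by blast+
  have e: "q x (e b) z = z \<bullet> b" for b z
    unfolding e_def by (rule riesz_works[OF bil pos]) (auto simp: S intro: linearI inner_add_left)
  \<comment> \<open>The vectors \<open>e b\<close> form the basis dual to the standard one at the
    fixed point x, so continuity and differentiability of the scalar functions
    \<open>q x (w y) b\<close> carry over to w.\<close>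
  have repr: "u = (\<Sum>b\<in>Basis. q x u b *\<^sub>R e b)" for u
  proof -
    have "riesz (q x) (q x u) = (\<Sum>b\<in>Basis. q x u b *\<^sub>R e b)"
    proof (rule riesz_eqI[OF bil pos])
      fix z
      have l: "linear (\<lambda>u. q x u z)" "linear (q x u)" using bil[OF S(2)] by (simp_all add: bilinear_def)
      show "q x (\<Sum>b\<in>Basis. q x u b *\<^sub>R e b) z = q x u z"
        by (simp add: linear_sum[OF l(1)] linear_cmul[OF l(1)] e linear_Basis_expansion[OF l(2), of z]
            mult.commute)
    qed (use S in auto)
    moreover have "riesz (q x) (q x u) = u"
      by (rule riesz_eqI[OF bil pos]) (use S in auto)
    ultimately show ?thesis by simp
  qed
  have eq: "q x (w y) z = \<alpha> y z - (\<Sum>b\<in>Basis. (q y b z - q x b z) * (w y \<bullet> b))" if y: "y \<in> S" for y z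
  proof -
    have "q y (w y) z = \<alpha> y z" unfolding w_def by (rule riesz_works[OF bil pos lin]) (use y in auto)
    moreover have "q y (w y) z - q x (w y) z = (\<Sum>b\<in>Basis. (q y b z - q x b z) * (w y \<bullet> b))"
      using linear_Basis_expansion[of "\<lambda>w. q y w z" "w y"] linear_Basis_expansion[of "\<lambda>w. q x w z" "w y"]
        bil[OF y] bil[OF S(2)]
      by (simp add: bilinear_def sum_subtractf algebra_simps)
    ultimately show ?thesis by simp
  qed
  have inS: "\<forall>\<^sub>F y in at x. y \<in> S" using S by (simp add: eventually_at_in_open')
  have wx: "q x (w x) z = \<alpha> x z" for z using eq[OF S(2)] by simp
  obtain K where K: "\<forall>\<^sub>F y in at x. norm (w y) \<le> K"
    using riesz_eventually_bounded[OF S bil pos lin qc \<alpha>c] unfolding w_def by blast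
  have "((\<lambda>y. q x (w y) z) \<longlongrightarrow> \<alpha> x z - (\<Sum>b\<in>(Basis::'e set). 0)) (at x)" for z
  proof (rule Lim_transform_eventually)
    show "((\<lambda>y. \<alpha> y z - (\<Sum>b\<in>Basis. (q y b z - q x b z) * (w y \<bullet> b)))
        \<longlongrightarrow> \<alpha> x z - (\<Sum>b\<in>(Basis::'e set). 0)) (at x)"
    proof (intro tendsto_diff tendsto_sum \<alpha>c[unfolded isCont_def])
      fix b :: 'e assume b: "b \<in> Basis"
      have 0: "((\<lambda>y. \<bar>q y b z - q x b z\<bar> * K) \<longlongrightarrow> 0) (at x)"
        using qc[of b z] unfolding isCont_def
        by (intro tendsto_mult_left_zero tendsto_rabs_zero LIM_zero)
      show "((\<lambda>y. (q y b z - q x b z) * (w y \<bullet> b)) \<longlongrightarrow> 0) (at x)"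
      proof (rule Lim_null_comparison[OF _ 0])
        show "\<forall>\<^sub>F y in at x. norm ((q y b z - q x b z) * (w y \<bullet> b)) \<le> \<bar>q y b z - q x b z\<bar> * K"
          using K
        proof eventually_elim
          case (elim y)
          then show ?case
            using Basis_le_norm[OF b, of "w y"] by (auto simp: abs_mult intro!: mult_left_mono)
        qed
      qed
    qed
    show "\<forall>\<^sub>F y in at x. \<alpha> y z - (\<Sum>b\<in>Basis. (q y b z - q x b z) * (w y \<bullet> b)) = q x (w y) z"
      using inS by eventually_elim (simp add: eq)
  qed
  then have "((\<lambda>y. \<Sum>b\<in>Basis. q x (w y) b *\<^sub>R e b) \<longlongrightarrow> (\<Sum>b\<in>Basis. q x (w x) b *\<^sub>R e b)) (at x)"
    by (intro tendsto_intros) (simp add: wx)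
  then have wc: "isCont w x"
    unfolding isCont_def repr[symmetric] .
  have "(\<lambda>y. q x (w y) z) differentiable (at x)" for z
  proof -
    obtain \<alpha>' where \<alpha>': "((\<lambda>y. \<alpha> y z) has_derivative \<alpha>') (at x)"
      using \<alpha> unfolding differentiable_def by blast
    define q' where "q' b = frechet_derivative (\<lambda>y. q y b z) (at x)" for b
    have q': "((\<lambda>y. q y b z) has_derivative q' b) (at x)" for b
      unfolding q'_def using q by (simp add: frechet_derivative_works)
    have "((\<lambda>y. (q y b z - q x b z) * (w y \<bullet> b)) has_derivative (\<lambda>h. q' b h * (w x \<bullet> b))) (at x)" for b
    proof (rule has_derivative_mult_continuous)
      show "((\<lambda>y. q y b z - q x b z) has_derivative q' b) (at x)"
        using has_derivative_diff[OF q' has_derivative_const] by simp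
    qed (use wc in auto)
    then have 1: "((\<lambda>y. \<alpha> y z - (\<Sum>b\<in>Basis. (q y b z - q x b z) * (w y \<bullet> b))) has_derivative
       (\<lambda>h. \<alpha>' h - (\<Sum>b\<in>Basis. q' b h * (w x \<bullet> b)))) (at x)"
      by (intro has_derivative_diff has_derivative_sum \<alpha>')
    show ?thesis
      by (rule differentiableI, rule has_derivative_transform_within_open[OF 1 S]) (simp add: eq)
  qed
  then have "(\<lambda>y. \<Sum>b\<in>Basis. q x (w y) b *\<^sub>R e b) differentiable (at x)"
    by (intro differentiable_sum differentiable_scaleR) auto
  then show ?thesis unfolding repr[symmetric] unfolding w_def .
qed

section \<open>Smooth functions on open sets, and linearity of the trace\<close>

lemma smooth_onD:
  assumes "smooth_on S F" "x \<in> S"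
  shows "F differentiable (at x)" "(\<lambda>y. frechet_derivative F (at y) v) differentiable (at x)"
proof -
  have "Ck_on (Suc (Suc 0)) S F" using assms by (simp only: smooth_on_def)
  then show "F differentiable (at x)" "(\<lambda>y. frechet_derivative F (at y) v) differentiable (at x)"
    using assms(2) by simp_all
qed

lemma Ck_on_cong:
  assumes "open S" "\<And>x. x \<in> S \<Longrightarrow> F x = G x" "Ck_on k S F"
  shows "Ck_on k S G"
  using assms(2,3)
proof (induction k arbitrary: F G)
  case 0
  then show ?case by (simp cong: continuous_on_cong)
next
  case (Suc k)
  have D: "(G has_derivative frechet_derivative F (at x)) (at x)" if x: "x \<in> S" for x
  proof -
    have "(F has_derivative frechet_derivative F (at x)) (at x)"
      using Suc.prems(2) x by (simp add: frechet_derivative_works[symmetric])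
    then show ?thesis
      by (rule has_derivative_transform_within_open[OF _ \<open>open S\<close> x]) (rule Suc.prems(1))
  qed
  have "Ck_on k S (\<lambda>x. frechet_derivative G (at x) v)" for v
    by (rule Suc.IH[of "\<lambda>x. frechet_derivative F (at x) v"])
      (use Suc.prems(2) frechet_derivative_at[OF D] in auto)
  then show ?case using differentiableI[OF D] by auto
qed

lemma smooth_on_Pair_const:
  fixes c :: "'c::real_normed_vector"
  assumes "open S" "smooth_on S G"
  shows "smooth_on S (\<lambda>x. (c, G x))"
proof -
  \<comment> \<open>The constant is generalised because differentiation replaces it by 0 in the
    induction step.\<close>
  have "Ck_on k S (\<lambda>x. (c, G x))" if "Ck_on k S G" for k and c :: 'c
    using that
  proof (induction k arbitrary: c G)
    case 0
    then show ?case by (simp add: continuous_on_Pair)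
  next
    case (Suc k)
    have D: "((\<lambda>x. (c, G x)) has_derivative (\<lambda>v. (0, frechet_derivative G (at x) v))) (at x)"
      if "x \<in> S" for x
      by (intro has_derivative_Pair has_derivative_const)
        (use Suc.prems that in \<open>auto simp: frechet_derivative_works[symmetric]\<close>)
    have "Ck_on k S (\<lambda>x. frechet_derivative (\<lambda>x. (c, G x)) (at x) v)" for v
    proof (rule Ck_on_cong[OF \<open>open S\<close>])
      show "Ck_on k S (\<lambda>x. (0 :: 'c, frechet_derivative G (at x) v))"
        using Suc by simp
      show "(0 :: 'c, frechet_derivative G (at x) v) = frechet_derivative (\<lambda>x. (c, G x)) (at x) v"
        if "x \<in> S" for x
        using frechet_derivative_at[OF D[OF that]] by (simp add: fun_eq_iff)
    qed
    then show ?case using differentiableI[OF D] by auto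
  qed
  then show ?thesis using assms(2) by (simp add: smooth_on_def)
qed

lemma smooth_on_empty: "smooth_on {} F"
proof -
  have "Ck_on k {} F" for k by (induction k arbitrary: F) auto
  then show ?thesis by (simp add: smooth_on_def)
qed

lemma metric_trace_add:
  "metric_trace q (\<lambda>u v. B u v + C u v) = metric_trace q B + metric_trace q C"
  by (simp add: metric_trace_def sum.distrib)

lemma metric_trace_scaleR_left:
  "metric_trace q (\<lambda>u v. b u v *\<^sub>R w) = metric_trace q b *\<^sub>R w"
  by (simp add: metric_trace_def scaleR_sum_left)

lemma metric_trace_scaleR_right:
  "metric_trace q (\<lambda>u v. c *\<^sub>R B u v) = c *\<^sub>R metric_trace q B"
  by (simp add: metric_trace_def scaleR_sum_right)

lemma metric_trace_Pair:
  "metric_trace q (\<lambda>u v. (B u v, C u v)) = (metric_trace q B, metric_trace q C)"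
  by (simp add: metric_trace_def sum_prod)

section \<open>Directional derivatives in charts\<close>

text \<open>A relational form of \<open>dirderiv\<close>: the rules for
  \<open>has_derivative\<close> then yield existence and value together, and
  \<open>dirderiv_eq\<close> reads off the value.\<close>

definition has_dirderiv ::
  "('i, 'm, 'e::euclidean_space) riem \<Rightarrow> 'i \<Rightarrow> ('m \<Rightarrow> 'b::real_normed_vector) \<Rightarrow> 'm \<Rightarrow> ('e \<Rightarrow> 'b) \<Rightarrow> bool" where
  "has_dirderiv M i F p D \<longleftrightarrow> ((F \<circ> chart_inv M i) has_derivative D) (at (coord M i p))"

definition dir_differentiable ::
  "('i, 'm, 'e::euclidean_space) riem \<Rightarrow> 'i \<Rightarrow> ('m \<Rightarrow> 'b::real_normed_vector) \<Rightarrow> 'm \<Rightarrow> bool" where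
  "dir_differentiable M i F p \<longleftrightarrow> (F \<circ> chart_inv M i) differentiable (at (coord M i p))"

definition twice_differentiable ::
  "('i, 'm, 'e::euclidean_space) riem \<Rightarrow> 'i \<Rightarrow> 'm set \<Rightarrow> ('m \<Rightarrow> 'b::real_normed_vector) \<Rightarrow> bool" where
  "twice_differentiable M i U F \<longleftrightarrow>
     (\<forall>p\<in>U. dir_differentiable M i F p \<and> (\<forall>u. dir_differentiable M i (\<lambda>q. dirderiv M i F q u) p))"

lemma dirderiv_eq: "has_dirderiv M i F p D \<Longrightarrow> dirderiv M i F p u = D u"
  unfolding has_dirderiv_def dirderiv_def by (drule frechet_derivative_at) simp

lemma has_dirderivI: "dir_differentiable M i F p \<Longrightarrow> has_dirderiv M i F p (dirderiv M i F p)"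
  unfolding has_dirderiv_def dirderiv_def[abs_def] dir_differentiable_def
  by (rule frechet_derivative_works[THEN iffD1])

lemma has_dirderiv_imp: "has_dirderiv M i F p D \<Longrightarrow> dir_differentiable M i F p"
  unfolding has_dirderiv_def dir_differentiable_def by (rule differentiableI)

lemma has_dirderiv_linear: "has_dirderiv M i F p D \<Longrightarrow> linear D"
  unfolding has_dirderiv_def by (rule has_derivative_linear)

lemma has_dirderiv_const: "has_dirderiv M i (\<lambda>_. c) p (\<lambda>_. 0)"
  unfolding has_dirderiv_def o_def by (rule has_derivative_const)

lemma dirderiv_const [simp]: "dirderiv M i (\<lambda>_. c) p u = 0"
  by (rule dirderiv_eq[OF has_dirderiv_const])

lemma has_dirderiv_add:
  "has_dirderiv M i F p D \<Longrightarrow> has_dirderiv M i G p E \<Longrightarrow>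
    has_dirderiv M i (\<lambda>q. F q + G q) p (\<lambda>u. D u + E u)"
  unfolding has_dirderiv_def o_def by (rule has_derivative_add)

text \<open>The point p is arbitrary here, so F and G are evaluated at
  \<open>chart_inv M i (coord M i p)\<close>; this simplifies to p once p lies in the chart
  domain.\<close>

lemma has_dirderiv_scaleR:
  "has_dirderiv M i F p D \<Longrightarrow> has_dirderiv M i G p E \<Longrightarrow>
    has_dirderiv M i (\<lambda>q. F q *\<^sub>R G q) p (\<lambda>u. D u *\<^sub>R G (chart_inv M i (coord M i p)) + F (chart_inv M i (coord M i p)) *\<^sub>R E u)"
  unfolding has_dirderiv_def o_def by (drule (1) has_derivative_scaleR) (simp add: add.commute)

lemma has_dirderiv_Pair:
  "has_dirderiv M i F p D \<Longrightarrow> has_dirderiv M i G p E \<Longrightarrow>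
    has_dirderiv M i (\<lambda>q. (F q, G q)) p (\<lambda>u. (D u, E u))"
  unfolding has_dirderiv_def o_def by (rule has_derivative_Pair)

lemma has_dirderiv_bounded_linear:
  "bounded_linear L \<Longrightarrow> has_dirderiv M i F p D \<Longrightarrow> has_dirderiv M i (\<lambda>q. L (F q)) p (\<lambda>u. L (D u))"
  unfolding has_dirderiv_def o_def by (rule bounded_linear.has_derivative)

section \<open>Calculus in the charts of a Riemannian manifold\<close>

locale riemannian =
  fixes M :: "('i, 'm::{t2_space,second_countable_topology}, 'e::euclidean_space) riem"
  assumes riemannian: "riemannian_manifold M"
begin

lemma smooth_manifold: "smooth_manifold M"
  using riemannian by (simp add: riemannian_manifold_def)

lemma open_chart_dom: "open (chart_dom M i)"
  using smooth_manifold by (simp add: smooth_manifold_def)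

lemma chart_homeomorphism:
  "homeomorphism (chart_dom M i) (coord M i ` chart_dom M i) (coord M i) (chart_inv M i)"
  using smooth_manifold by (simp add: smooth_manifold_def)

lemma chart_inv_coord [simp]: "p \<in> chart_dom M i \<Longrightarrow> chart_inv M i (coord M i p) = p"
  by (rule homeomorphism_apply1[OF chart_homeomorphism])

lemma open_coord_image:
  assumes "open U" "U \<subseteq> chart_dom M i"
  shows "open (coord M i ` U)"
proof -
  have "openin (top_of_set (chart_dom M i)) U"
    using assms open_chart_dom by (simp add: openin_open_eq)
  then have "openin (top_of_set (coord M i ` chart_dom M i)) (coord M i ` U)"
    by (rule homeomorphism_imp_open_map[OF chart_homeomorphism])
  moreover have "open (coord M i ` chart_dom M i)"
    using smooth_manifold by (simp add: smooth_manifold_def)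
  ultimately show ?thesis by (simp add: openin_open_eq)
qed

text \<open>Charts are homeomorphisms, so agreement near p inside the chart domain is agreement on
  an open set of coordinates. The set U is typically the domain of a second chart, where formulas
  for the inclusion hold.\<close>

lemma has_dirderiv_cong:
  assumes F: "has_dirderiv M i F p D" and U: "open U" "p \<in> U" "p \<in> chart_dom M i"
    and FG: "\<And>q. q \<in> U \<Longrightarrow> q \<in> chart_dom M i \<Longrightarrow> F q = G q"
  shows "has_dirderiv M i G p D"
  unfolding has_dirderiv_def
proof (rule has_derivative_transform_within_open[OF F[unfolded has_dirderiv_def]])
  show "open (coord M i ` (U \<inter> chart_dom M i))"
    using open_coord_image U(1) open_chart_dom by (simp add: open_Int)
  show "coord M i p \<in> coord M i ` (U \<inter> chart_dom M i)" using U by blast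
  show "(F \<circ> chart_inv M i) x = (G \<circ> chart_inv M i) x" if "x \<in> coord M i ` (U \<inter> chart_dom M i)" for x
    using that FG by auto
qed

lemma dir_differentiable_cong:
  assumes "dir_differentiable M i F p" "open U" "p \<in> U" "p \<in> chart_dom M i"
    and "\<And>q. q \<in> U \<Longrightarrow> q \<in> chart_dom M i \<Longrightarrow> F q = G q"
  shows "dir_differentiable M i G p"
  by (rule has_dirderiv_imp[OF has_dirderiv_cong[OF has_dirderivI[OF assms(1)] assms(2-)]])

lemma dirderiv_cong:
  assumes "dir_differentiable M i F p" "open U" "p \<in> U" "p \<in> chart_dom M i"
    and "\<And>q. q \<in> U \<Longrightarrow> q \<in> chart_dom M i \<Longrightarrow> F q = G q"
  shows "dirderiv M i F p = dirderiv M i G p"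
  by (rule ext, rule dirderiv_eq[symmetric], rule has_dirderiv_cong[OF has_dirderivI[OF assms(1)] assms(2-)])

lemma smooth_imp_twice_differentiable:
  assumes F: "smooth_on (coord M i ` U) (F \<circ> chart_inv M i)" and U: "open U" "U \<subseteq> chart_dom M i"
  shows "twice_differentiable M i U F"
  unfolding twice_differentiable_def dir_differentiable_def
proof (intro ballI conjI allI)
  fix p u assume p: "p \<in> U"
  then have x: "coord M i p \<in> coord M i ` U" by blast
  show "(F \<circ> chart_inv M i) differentiable at (coord M i p)"
    by (rule smooth_onD(1)[OF F x])
  show "((\<lambda>q. dirderiv M i F q u) \<circ> chart_inv M i) differentiable at (coord M i p)"
  proof (rule differentiableI, rule has_derivative_transform_within_open[OF _ _ x])
    show "((\<lambda>y. frechet_derivative (F \<circ> chart_inv M i) (at y) u) has_derivative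
        frechet_derivative (\<lambda>y. frechet_derivative (F \<circ> chart_inv M i) (at y) u) (at (coord M i p)))
        (at (coord M i p))"
      using smooth_onD(2)[OF F x] by (simp add: frechet_derivative_works)
    show "open (coord M i ` U)" by (rule open_coord_image[OF U])
    show "frechet_derivative (F \<circ> chart_inv M i) (at y) u = ((\<lambda>q. dirderiv M i F q u) \<circ> chart_inv M i) y"
      if "y \<in> coord M i ` U" for y
      using that U(2) by (auto simp: dirderiv_def)
  qed
qed

lemma second_dirderiv_symmetric:
  fixes F :: "'m \<Rightarrow> 'b::euclidean_space"
  assumes F: "twice_differentiable M i U F" and U: "open U" "U \<subseteq> chart_dom M i" and p: "p \<in> U"
  shows "dirderiv M i (\<lambda>q. dirderiv M i F q u) p v = dirderiv M i (\<lambda>q. dirderiv M i F q v) p u"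
proof (rule second_derivative_symmetric[of "coord M i ` U" "coord M i p" "F \<circ> chart_inv M i"
      "\<lambda>y w. ((\<lambda>q. dirderiv M i F q w) \<circ> chart_inv M i) y"])
  show "open (coord M i ` U)" by (rule open_coord_image[OF U])
  show "coord M i p \<in> coord M i ` U" using p by blast
  show "(F \<circ> chart_inv M i has_derivative (\<lambda>w. ((\<lambda>q. dirderiv M i F q w) \<circ> chart_inv M i) y)) (at y)"
    if y: "y \<in> coord M i ` U" for y
  proof -
    obtain q where q: "q \<in> U" "y = coord M i q" using y by blast
    then have "has_dirderiv M i F q (dirderiv M i F q)"
      using F by (intro has_dirderivI) (auto simp: twice_differentiable_def)
    then show ?thesis
      using q U(2) by (auto simp: has_dirderiv_def subsetD)
  qed
  have "has_dirderiv M i (\<lambda>q. dirderiv M i F q w) p (dirderiv M i (\<lambda>q. dirderiv M i F q w) p)" for w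
    using F p by (intro has_dirderivI) (auto simp: twice_differentiable_def)
  then have L: "((\<lambda>y. ((\<lambda>q. dirderiv M i F q w) \<circ> chart_inv M i) y) has_derivative
      dirderiv M i (\<lambda>q. dirderiv M i F q w) p) (at (coord M i p))" for w
    by (simp add: has_dirderiv_def o_def)
  show "((\<lambda>y. ((\<lambda>q. dirderiv M i F q u) \<circ> chart_inv M i) y) has_derivative
      dirderiv M i (\<lambda>q. dirderiv M i F q u) p) (at (coord M i p))" by (rule L)
  show "((\<lambda>y. ((\<lambda>q. dirderiv M i F q v) \<circ> chart_inv M i) y) has_derivative
      dirderiv M i (\<lambda>q. dirderiv M i F q v) p) (at (coord M i p))" by (rule L)
qed

lemma metric_bilinear: "p \<in> chart_dom M i \<Longrightarrow> bilinear (metric M i p)"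
  using riemannian unfolding riemannian_manifold_def by blast

lemma metric_commute: "p \<in> chart_dom M i \<Longrightarrow> metric M i p u v = metric M i p v u"
  using riemannian unfolding riemannian_manifold_def by blast

lemma metric_pos: "p \<in> chart_dom M i \<Longrightarrow> u \<noteq> 0 \<Longrightarrow> metric M i p u u > 0"
  using riemannian unfolding riemannian_manifold_def by blast

lemmas metric_linear =
  bilinear_ladd[OF metric_bilinear] bilinear_radd[OF metric_bilinear]
  bilinear_lsub[OF metric_bilinear] bilinear_rsub[OF metric_bilinear]
  bilinear_lmul[OF metric_bilinear] bilinear_rmul[OF metric_bilinear]
  bilinear_lzero[OF metric_bilinear] bilinear_rzero[OF metric_bilinear]
  bilinear_lneg[OF metric_bilinear] bilinear_rneg[OF metric_bilinear]

lemma metric_eqI: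
  assumes "p \<in> chart_dom M i" "\<And>z. metric M i p u z = metric M i p v z"
  shows "u = v"
proof -
  have "metric M i p (u - v) (u - v) = 0"
    using assms by (simp add: metric_linear)
  then show ?thesis using metric_pos[OF assms(1), of "u - v"] by fastforce
qed

lemma metric_riesz:
  assumes "p \<in> chart_dom M i" "linear \<alpha>"
  shows "metric M i p (riesz (metric M i p) \<alpha>) z = \<alpha> z"
  by (rule riesz_works) (use assms metric_bilinear metric_pos in auto)

lemma metric_differentiable:
  "p \<in> chart_dom M i \<Longrightarrow> dir_differentiable M i (\<lambda>q. metric M i q u v) p"
  "p \<in> chart_dom M i \<Longrightarrow> dir_differentiable M i (\<lambda>q. dirderiv M i (\<lambda>q. metric M i q u v) q w) p"
proof -
  have "smooth_on (coord M i ` chart_dom M i) ((\<lambda>q. metric M i q u v) \<circ> chart_inv M i)"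
    using riemannian unfolding riemannian_manifold_def o_def by blast
  then have "twice_differentiable M i (chart_dom M i) (\<lambda>q. metric M i q u v)"
    by (rule smooth_imp_twice_differentiable[OF _ open_chart_dom order_refl])
  then show "p \<in> chart_dom M i \<Longrightarrow> dir_differentiable M i (\<lambda>q. metric M i q u v) p"
    "p \<in> chart_dom M i \<Longrightarrow> dir_differentiable M i (\<lambda>q. dirderiv M i (\<lambda>q. metric M i q u v) q w) p"
    by (auto simp: twice_differentiable_def)
qed

text \<open>The Leibniz rule for fields with varying components. In the first term the fields are
  frozen at p and only the metric is differentiated.\<close>

lemma has_dirderiv_metric:
  assumes p: "p \<in> chart_dom M i" and V: "has_dirderiv M i V p V'" and W: "has_dirderiv M i W p W'"
  shows "has_dirderiv M i (\<lambda>q. metric M i q (V q) (W q)) p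
    (\<lambda>h. dirderiv M i (\<lambda>q. metric M i q (V p) (W p)) p h
      + metric M i p (V' h) (W p) + metric M i p (V p) (W' h))"
proof -
  have "((\<lambda>y. metric M i (chart_inv M i y) ((V \<circ> chart_inv M i) y) ((W \<circ> chart_inv M i) y)) has_derivative
    (\<lambda>h. dirderiv M i (\<lambda>q. metric M i q ((V \<circ> chart_inv M i) (coord M i p)) ((W \<circ> chart_inv M i) (coord M i p))) p h
      + metric M i (chart_inv M i (coord M i p)) (V' h) ((W \<circ> chart_inv M i) (coord M i p))
      + metric M i (chart_inv M i (coord M i p)) ((V \<circ> chart_inv M i) (coord M i p)) (W' h))) (at (coord M i p))"
  proof (rule has_derivative_bilinear_family)
    show "open (coord M i ` chart_dom M i)" by (rule open_coord_image[OF open_chart_dom order_refl])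
    show "coord M i p \<in> coord M i ` chart_dom M i" using p by blast
    show "bilinear (metric M i (chart_inv M i y))" if "y \<in> coord M i ` chart_dom M i" for y
      using that metric_bilinear by auto
    show "((\<lambda>y. metric M i (chart_inv M i y) u v) has_derivative
        dirderiv M i (\<lambda>q. metric M i q u v) p) (at (coord M i p))" for u v
      using has_dirderivI[OF metric_differentiable(1)[OF p]] by (simp add: has_dirderiv_def o_def)
  qed (use V W in \<open>simp_all add: has_dirderiv_def o_def\<close>)
  then show ?thesis using p by (simp add: has_dirderiv_def o_def)
qed

lemma dirderiv_metric_commute:
  assumes "p \<in> chart_dom M i"
  shows "dirderiv M i (\<lambda>q. metric M i q u v) p = dirderiv M i (\<lambda>q. metric M i q v u) p"
  by (rule dirderiv_cong[OF metric_differentiable(1)[OF assms] open_chart_dom assms assms])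
    (rule metric_commute)

lemma linear_dirderiv: "dir_differentiable M i F p \<Longrightarrow> linear (dirderiv M i F p)"
  by (rule has_dirderiv_linear[OF has_dirderivI])

lemma dirderiv_metric_linear:
  assumes p: "p \<in> chart_dom M i"
  shows "dirderiv M i (\<lambda>q. metric M i q u (v + v')) p h
      = dirderiv M i (\<lambda>q. metric M i q u v) p h + dirderiv M i (\<lambda>q. metric M i q u v') p h"
    and "dirderiv M i (\<lambda>q. metric M i q u (c *\<^sub>R v)) p h = c * dirderiv M i (\<lambda>q. metric M i q u v) p h"
proof -
  note d = has_dirderivI[OF metric_differentiable(1)[OF p]]
  have "has_dirderiv M i (\<lambda>q. metric M i q u (v + v')) p (\<lambda>h.
      dirderiv M i (\<lambda>q. metric M i q u v) p h + dirderiv M i (\<lambda>q. metric M i q u v') p h)"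
    by (rule has_dirderiv_cong[OF has_dirderiv_add[OF d d] open_chart_dom p p]) (simp add: metric_linear)
  then show "dirderiv M i (\<lambda>q. metric M i q u (v + v')) p h
      = dirderiv M i (\<lambda>q. metric M i q u v) p h + dirderiv M i (\<lambda>q. metric M i q u v') p h"
    by (rule dirderiv_eq)
  have "has_dirderiv M i (\<lambda>q. metric M i q u (c *\<^sub>R v)) p (\<lambda>h. c *\<^sub>R dirderiv M i (\<lambda>q. metric M i q u v) p h)"
    by (rule has_dirderiv_cong[OF has_dirderiv_bounded_linear[OF bounded_linear_scaleR_right d]
          open_chart_dom p p]) (simp add: metric_linear)
  from dirderiv_eq[OF this]
  show "dirderiv M i (\<lambda>q. metric M i q u (c *\<^sub>R v)) p h = c * dirderiv M i (\<lambda>q. metric M i q u v) p h"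
    by simp
qed

lemma dirderiv_linear:
  assumes "dir_differentiable M i F p"
  shows "dirderiv M i F p (u + v) = dirderiv M i F p u + dirderiv M i F p v"
    and "dirderiv M i F p (c *\<^sub>R v) = c *\<^sub>R dirderiv M i F p v"
    and "dirderiv M i F p 0 = 0"
  using linear_dirderiv[OF assms] by (simp_all add: linear_add linear_cmul linear_0)

section \<open>The Levi-Civita connection in coordinates\<close>

lemma linear_koszul:
  assumes p: "p \<in> chart_dom M i"
  shows "linear (\<lambda>z. (dirderiv M i (\<lambda>q. metric M i q v z) p u
      + dirderiv M i (\<lambda>q. metric M i q u z) p v - dirderiv M i (\<lambda>q. metric M i q u v) p z) / 2)"
  using dirderiv_linear[OF metric_differentiable(1)[OF p]]
  by (intro linearI) (simp_all add: dirderiv_metric_linear[OF p] field_simps)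

lemma koszul:
  assumes p: "p \<in> chart_dom M i"
  shows "metric M i p (christoffel M i p u v) z =
    (dirderiv M i (\<lambda>q. metric M i q v z) p u
      + dirderiv M i (\<lambda>q. metric M i q u z) p v
      - dirderiv M i (\<lambda>q. metric M i q u v) p z) / 2"
  unfolding christoffel_def by (rule metric_riesz[OF p linear_koszul[OF p]])

text \<open>Absence of torsion: the Koszul expression is symmetric in u and v.\<close>

lemma christoffel_commute:
  assumes p: "p \<in> chart_dom M i"
  shows "christoffel M i p u v = christoffel M i p v u"
  by (rule metric_eqI[OF p]) (simp add: koszul[OF p] dirderiv_metric_commute[OF p, of u v])

lemma christoffel_scaleR_right:
  assumes p: "p \<in> chart_dom M i"
  shows "christoffel M i p u (c *\<^sub>R v) = c *\<^sub>R christoffel M i p u v"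
proof (rule metric_eqI[OF p])
  fix z
  have "dirderiv M i (\<lambda>q. metric M i q (c *\<^sub>R v) z) p u = c * dirderiv M i (\<lambda>q. metric M i q v z) p u" for u
    using dirderiv_metric_commute[OF p, of _ z] dirderiv_metric_linear(2)[OF p, of z c v u] by simp
  then show "metric M i p (christoffel M i p u (c *\<^sub>R v)) z = metric M i p (c *\<^sub>R christoffel M i p u v) z"
    using dirderiv_linear(2)[OF metric_differentiable(1)[OF p]] p
    by (simp add: koszul[OF p] metric_linear dirderiv_metric_linear[OF p] field_simps)
qed

lemma riesz_metric_differentiable:
  assumes p: "p \<in> chart_dom M i"
    and lin: "\<And>q. q \<in> chart_dom M i \<Longrightarrow> linear (\<alpha> q)"
    and \<alpha>: "\<And>z. dir_differentiable M i (\<lambda>q. \<alpha> q z) p"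
  shows "dir_differentiable M i (\<lambda>q. riesz (metric M i q) (\<alpha> q)) p"
  unfolding dir_differentiable_def o_def
proof (rule riesz_differentiable)
  show "open (coord M i ` chart_dom M i)" by (rule open_coord_image[OF open_chart_dom order_refl])
  show "coord M i p \<in> coord M i ` chart_dom M i" using p by blast
qed (use metric_bilinear metric_pos lin \<alpha> metric_differentiable(1)[OF p] in
    \<open>auto simp: dir_differentiable_def o_def\<close>)

lemma dir_differentiable_intros:
  "dir_differentiable M i F p \<Longrightarrow> dir_differentiable M i G p \<Longrightarrow> dir_differentiable M i (\<lambda>q. F q + G q) p"
  "dir_differentiable M i F p \<Longrightarrow> dir_differentiable M i G p \<Longrightarrow> dir_differentiable M i (\<lambda>q. F q - G q) p"
  "dir_differentiable M i H p \<Longrightarrow> dir_differentiable M i F p \<Longrightarrow> dir_differentiable M i (\<lambda>q. H q *\<^sub>R F q) p"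
  "dir_differentiable M i H p \<Longrightarrow> dir_differentiable M i (\<lambda>q. H q / c) p"
  for H :: "_ \<Rightarrow> real"
  unfolding dir_differentiable_def o_def divide_inverse
  by (auto intro!: differentiable_add differentiable_diff differentiable_scaleR differentiable_mult)

lemma christoffel_differentiable:
  assumes p: "p \<in> chart_dom M i"
  shows "dir_differentiable M i (\<lambda>q. christoffel M i q u v) p"
  unfolding christoffel_def
  by (rule riesz_metric_differentiable[OF p linear_koszul])
    (auto intro!: dir_differentiable_intros metric_differentiable p)

section \<open>Gradients\<close>

lemma metric_grad:
  assumes "p \<in> chart_dom M i" "dir_differentiable M i F p"
  shows "metric M i p (grad M i F p) z = dirderiv M i F p z"
  unfolding grad_def by (rule metric_riesz[OF assms(1) linear_dirderiv[OF assms(2)]])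

lemma grad_differentiable:
  assumes F: "twice_differentiable M i (chart_dom M i) F" and p: "p \<in> chart_dom M i"
  shows "dir_differentiable M i (grad M i F) p"
proof -
  have "dir_differentiable M i (\<lambda>q. riesz (metric M i q) (dirderiv M i F q)) p"
    using F p by (intro riesz_metric_differentiable linear_dirderiv) (auto simp: twice_differentiable_def)
  then show ?thesis by (simp add: grad_def[abs_def])
qed

text \<open>With G = grad F, the derivative of g(G, G) along z is 2 g(nabla_z G, G), and by symmetry
  of the Hessian this is 2 g(nabla_G G, z).\<close>

lemma grad_sqnorm_grad:
  assumes F: "twice_differentiable M i (chart_dom M i) F" and p: "p \<in> chart_dom M i"
  shows "grad M i (\<lambda>x. sqnorm M i x (grad M i F x)) p = 2 *\<^sub>R nabla M i (grad M i F) (grad M i F) p"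
proof -
  let ?G = "grad M i F"
  let ?g = "metric M i p"
  let ?D = "\<lambda>u v h. dirderiv M i (\<lambda>q. metric M i q u v) p h"
  have dG: "has_dirderiv M i ?G p (dirderiv M i ?G p)"
    by (rule has_dirderivI[OF grad_differentiable[OF F p]])
  have hess: "dirderiv M i (\<lambda>q. dirderiv M i F q z) p h = ?D (?G p) z h + ?g (dirderiv M i ?G p h) z" for z h
  proof (rule dirderiv_eq)
    have "has_dirderiv M i (\<lambda>q. metric M i q (?G q) z) p (\<lambda>h. ?D (?G p) z h + ?g (dirderiv M i ?G p h) z)"
      using has_dirderiv_metric[OF p dG has_dirderiv_const] p by (simp add: metric_linear)
    then show "has_dirderiv M i (\<lambda>q. dirderiv M i F q z) p
        (\<lambda>h. ?D (?G p) z h + ?g (dirderiv M i ?G p h) z)"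
      by (rule has_dirderiv_cong[OF _ open_chart_dom p p])
        (use F in \<open>auto simp: metric_grad twice_differentiable_def\<close>)
  qed
  \<comment> \<open>Both sides are second derivatives of F, obtained by differentiating g(G, z) =
    dF(z) for constant z. With h = G(p) this trades the derivative of G along z for the one along
    G.\<close>
  have sym: "?D (?G p) z h + ?g (dirderiv M i ?G p h) z = ?D (?G p) h z + ?g (dirderiv M i ?G p z) h" for z h
    using second_dirderiv_symmetric[OF F open_chart_dom order_refl p, of z h] by (simp add: hess)
  have "has_dirderiv M i (\<lambda>x. metric M i x (?G x) (?G x)) p (\<lambda>h. ?D (?G p) (?G p) h
      + ?g (dirderiv M i ?G p h) (?G p) + ?g (?G p) (dirderiv M i ?G p h))"
    by (rule has_dirderiv_metric[OF p dG dG])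
  note D = dirderiv_eq[OF this]
  show ?thesis
    unfolding grad_def[of M i "\<lambda>x. sqnorm M i x (?G x)"]
  proof (rule riesz_eqI)
    fix z
    show "?g (2 *\<^sub>R nabla M i ?G ?G p) z = dirderiv M i (\<lambda>x. sqnorm M i x (?G x)) p z"
    proof -
      have "?g (christoffel M i p (?G p) (?G p)) z = ?D (?G p) z (?G p) - ?D (?G p) (?G p) z / 2"
        by (simp add: koszul[OF p])
      then show ?thesis
        using sym[of z "?G p"] metric_commute[OF p, of "?G p" "dirderiv M i ?G p z"]
        by (simp add: sqnorm_def D nabla_def metric_linear[OF p])
    qed
  qed (use metric_bilinear[OF p] metric_pos[OF p] in auto)
qed

section \<open>Change of charts\<close>

lemma dirderiv_coord_self:
  assumes p: "p \<in> chart_dom M i"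
  shows "dirderiv M i (coord M i) p u = u"
proof -
  have "((\<lambda>x. x) has_derivative (\<lambda>u. u)) (at (coord M i p))" by (rule has_derivative_ident)
  then have "has_dirderiv M i (coord M i) p (\<lambda>u. u)"
    unfolding has_dirderiv_def
    by (rule has_derivative_transform_within_open[OF _ open_coord_image[OF open_chart_dom order_refl]])
      (use p in auto)
  then show ?thesis by (rule dirderiv_eq)
qed

lemma coord_twice_differentiable:
  "twice_differentiable M j (chart_dom M j \<inter> chart_dom M j') (coord M j')"
  using smooth_manifold open_chart_dom
  by (intro smooth_imp_twice_differentiable open_Int) (auto simp: smooth_manifold_def)

lemma coord_differentiable:
  assumes "p \<in> chart_dom M j" "p \<in> chart_dom M j'"
  shows "dir_differentiable M j (coord M j') p"
    and "dir_differentiable M j (\<lambda>q. dirderiv M j (coord M j') q u) p"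
  using coord_twice_differentiable[of j j'] assms by (auto simp: twice_differentiable_def)

lemma has_dirderiv_change_chart:
  assumes p: "p \<in> chart_dom M j" "p \<in> chart_dom M j'" and F: "has_dirderiv M j' F p D"
  shows "has_dirderiv M j F p (\<lambda>u. D (dirderiv M j (coord M j') p u))"
proof -
  have "((F \<circ> chart_inv M j') \<circ> (coord M j' \<circ> chart_inv M j) has_derivative
      D \<circ> dirderiv M j (coord M j') p) (at (coord M j p))"
    using F has_dirderivI[OF coord_differentiable(1)[OF p]] p
    by (intro diff_chain_at) (simp_all add: has_dirderiv_def)
  then have "has_dirderiv M j (\<lambda>q. F (chart_inv M j' (coord M j' q))) p (\<lambda>u. D (dirderiv M j (coord M j') p u))"
    by (simp add: has_dirderiv_def o_def)
  then show ?thesis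
    by (rule has_dirderiv_cong[OF _ open_chart_dom p(2) p(1)]) simp
qed

lemma metric_change_chart:
  assumes "p \<in> chart_dom M j" "p \<in> chart_dom M j'"
  shows "metric M j p u v
    = metric M j' p (dirderiv M j (coord M j') p u) (dirderiv M j (coord M j') p v)"
  using riemannian assms unfolding riemannian_manifold_def by blast

text \<open>The differential is an isometry between the two coordinate metrics, hence injective, and
  source and target have the same dimension.\<close>

lemma surj_dirderiv_coord:
  assumes p: "p \<in> chart_dom M j" "p \<in> chart_dom M j'"
  shows "surj (dirderiv M j (coord M j') p)"
proof -
  have lin: "linear (dirderiv M j (coord M j') p)"
    by (rule linear_dirderiv[OF coord_differentiable(1)[OF p]])
  have "inj (dirderiv M j (coord M j') p)"
  proof (rule linear_injective_0[OF lin, THEN iffD2, rule_format])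
    fix u assume "dirderiv M j (coord M j') p u = 0"
    then have "metric M j p u u = 0"
      using metric_change_chart[OF p, of u u] p by (simp add: metric_linear)
    then show "u = 0" using metric_pos[OF p(1), of u] by fastforce
  qed
  then show ?thesis by (rule linear_injective_imp_surjective[OF lin _ refl])
qed

text \<open>Differentiate \<open>g(u, v) = g'(A u, A v)\<close> and insert this into the Koszul formula; by symmetry of
  the second derivatives of the coordinate change, all but one of its terms cancel.\<close>

lemma christoffel_change_chart:
  assumes p: "p \<in> chart_dom M j" "p \<in> chart_dom M j'"
  defines "A \<equiv> dirderiv M j (coord M j')"
  shows "dirderiv M j (\<lambda>q. A q v) p u + christoffel M j' p (A p u) (A p v) = A p (christoffel M j p u v)"
proof (rule metric_eqI[OF p(2)])
  fix z'
  obtain z where z: "z' = A p z"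
    using surj_dirderiv_coord[OF p] unfolding A_def by (rule surjE)
  let ?g = "metric M j' p"
  let ?U = "chart_dom M j \<inter> chart_dom M j'"
  let ?D = "\<lambda>u v h. dirderiv M j' (\<lambda>q. metric M j' q u v) p h"
  define H where "H v h = dirderiv M j (\<lambda>q. A q v) p h" for v h
  have H_sym: "H v h = H h v" for v h
    unfolding H_def A_def
    by (rule second_dirderiv_symmetric[OF coord_twice_differentiable])
      (use p open_chart_dom in auto)
  have U: "open ?U" by (intro open_Int open_chart_dom)
  have dA: "has_dirderiv M j (\<lambda>q. A q u) p (H u)" for u
    unfolding A_def H_def[abs_def] by (rule has_dirderivI[OF coord_differentiable(2)[OF p]])
  have D: "dirderiv M j (\<lambda>q. metric M j q u v) p h
      = ?D (A p u) (A p v) (A p h) + ?g (H u h) (A p v) + ?g (A p u) (H v h)" for u v h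
  proof (rule dirderiv_eq)
    have "((\<lambda>y. metric M j' (chart_inv M j y) (((\<lambda>q. A q u) \<circ> chart_inv M j) y)
          (((\<lambda>q. A q v) \<circ> chart_inv M j) y)) has_derivative
      (\<lambda>h. ?D (((\<lambda>q. A q u) \<circ> chart_inv M j) (coord M j p)) (((\<lambda>q. A q v) \<circ> chart_inv M j) (coord M j p)) (A p h)
        + metric M j' (chart_inv M j (coord M j p)) (H u h) (((\<lambda>q. A q v) \<circ> chart_inv M j) (coord M j p))
        + metric M j' (chart_inv M j (coord M j p)) (((\<lambda>q. A q u) \<circ> chart_inv M j) (coord M j p)) (H v h)))
      (at (coord M j p))"
    proof (rule has_derivative_bilinear_family)
      show "open (coord M j ` ?U)" by (rule open_coord_image[OF U]) blast
      show "coord M j p \<in> coord M j ` ?U" using p by blast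
      show "bilinear (metric M j' (chart_inv M j y))" if "y \<in> coord M j ` ?U" for y
        using that metric_bilinear by auto
      show "((\<lambda>y. metric M j' (chart_inv M j y) a b) has_derivative (\<lambda>h. ?D a b (A p h))) (at (coord M j p))"
        for a b
        using has_dirderiv_change_chart[OF p has_dirderivI[OF metric_differentiable(1)[OF p(2)]]]
        by (simp add: has_dirderiv_def o_def A_def)
    qed (use dA[of u] dA[of v] in \<open>simp_all add: has_dirderiv_def o_def\<close>)
    then have "has_dirderiv M j (\<lambda>q. metric M j' q (A q u) (A q v)) p
      (\<lambda>h. ?D (A p u) (A p v) (A p h) + ?g (H u h) (A p v) + ?g (A p u) (H v h))"
      using p by (simp add: has_dirderiv_def o_def)
    then show "has_dirderiv M j (\<lambda>q. metric M j q u v) p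
      (\<lambda>h. ?D (A p u) (A p v) (A p h) + ?g (H u h) (A p v) + ?g (A p u) (H v h))"
      by (rule has_dirderiv_cong[OF _ U])
        (use p in \<open>auto simp: A_def intro!: metric_change_chart[symmetric]\<close>)
  qed
  have "?g (A p (christoffel M j p u v)) (A p z) = metric M j p (christoffel M j p u v) z"
    unfolding A_def by (rule metric_change_chart[OF p, symmetric])
  also have "\<dots> = ?g (H v u) (A p z) + ?g (christoffel M j' p (A p u) (A p v)) (A p z)"
    unfolding koszul[OF p(1)] koszul[OF p(2)] D H_sym[of u v] H_sym[of u z] H_sym[of v z]
      metric_commute[OF p(2), of "A p v" "H z u"]
    by (simp add: add_divide_distrib diff_divide_distrib)
  finally show "?g (dirderiv M j (\<lambda>q. A q v) p u + christoffel M j' p (A p u) (A p v)) z'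
      = ?g (A p (christoffel M j p u v)) z'"
    using p by (simp add: z H_def metric_linear)
qed

section \<open>Traces and Hessians\<close>

lemma christoffel_zero [simp]:
  assumes "p \<in> chart_dom M i"
  shows "christoffel M i p u 0 = 0" "christoffel M i p 0 u = 0"
  using christoffel_scaleR_right[OF assms, of u 0 0] christoffel_commute[OF assms, of 0 u] by simp_all

lemma metric_dual:
  assumes p: "p \<in> chart_dom M i"
  shows "metric M i p (riesz (metric M i p) (\<lambda>z. z \<bullet> b)) z = z \<bullet> b"
  by (rule metric_riesz[OF p]) (intro linearI; simp add: inner_add_left)

lemma metric_trace_metric:
  assumes p: "p \<in> chart_dom M i"
  shows "metric_trace (metric M i p) (metric M i p) = real DIM('e)"
  by (simp add: metric_trace_def metric_dual[OF p] inner_Basis)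

text \<open>Contracting dF with the dual basis gives the gradient. The two versions serve the two
  mixed terms of the second covariant derivative along the inclusion.\<close>

lemma metric_trace_dirderiv:
  fixes A :: "'e \<Rightarrow> 'b::real_vector"
  assumes p: "p \<in> chart_dom M i" and F: "dir_differentiable M i F p" and A: "linear A"
  shows "metric_trace (metric M i p) (\<lambda>u v. dirderiv M i F p u *\<^sub>R A v) = A (grad M i F p)"
    and "metric_trace (metric M i p) (\<lambda>u v. dirderiv M i F p v *\<^sub>R A u) = A (grad M i F p)"
proof -
  let ?g = "metric M i p"
  have d: "dirderiv M i F p (riesz ?g (\<lambda>z. z \<bullet> b)) = grad M i F p \<bullet> b" for b
    using metric_grad[OF p F, of "riesz ?g (\<lambda>z. z \<bullet> b)"] metric_dual[OF p, of b "grad M i F p"]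
      metric_commute[OF p] by metis
  show "metric_trace ?g (\<lambda>u v. dirderiv M i F p u *\<^sub>R A v) = A (grad M i F p)"
    by (simp add: metric_trace_def d linear_Basis_expansion[OF A, of "grad M i F p"])
  have "(\<Sum>b\<in>Basis. dirderiv M i F p b *\<^sub>R riesz ?g (\<lambda>z. z \<bullet> b)) = grad M i F p"
  proof (rule metric_eqI[OF p])
    fix z
    have l: "linear (\<lambda>u. ?g u z)" using metric_bilinear[OF p] by (simp add: bilinear_def)
    show "?g (\<Sum>b\<in>Basis. dirderiv M i F p b *\<^sub>R riesz ?g (\<lambda>z. z \<bullet> b)) z = ?g (grad M i F p) z"
      by (simp add: linear_sum[OF l] linear_cmul[OF l] metric_dual[OF p] metric_grad[OF p F]
          linear_Basis_expansion[OF linear_dirderiv[OF F], of z] mult.commute)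
  qed
  then show "metric_trace ?g (\<lambda>u v. dirderiv M i F p v *\<^sub>R A u) = A (grad M i F p)"
    by (simp add: metric_trace_def flip: linear_cmul[OF A] linear_sum[OF A])
qed

lemma smooth_fun_differentiable:
  assumes F: "smooth_fun M F" and p: "p \<in> chart_dom M i"
  shows "dir_differentiable M i F p" "dir_differentiable M i (\<lambda>q. dirderiv M i F q u) p"
proof -
  have "twice_differentiable M i (chart_dom M i) F"
    using F open_chart_dom by (intro smooth_imp_twice_differentiable) (auto simp: smooth_fun_def)
  then show "dir_differentiable M i F p" "dir_differentiable M i (\<lambda>q. dirderiv M i F q u) p"
    using p by (auto simp: twice_differentiable_def)
qed

text \<open>The covariant Hessian nabla dF, evaluated on fields with constant components.\<close>

definition hessian :: "'i \<Rightarrow> ('m \<Rightarrow> real) \<Rightarrow> 'm \<Rightarrow> 'e \<Rightarrow> 'e \<Rightarrow> real" where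
  "hessian i F p u v = dirderiv M i (\<lambda>q. dirderiv M i F q v) p u - dirderiv M i F p (christoffel M i p u v)"

text \<open>Both quantities contain derivatives of dF or of the gradient, so vanishing is required
  on the whole chart domain and not just at p.\<close>

lemma grad_zero_imp:
  assumes F: "smooth_fun M F" and p: "p \<in> chart_dom M i"
    and g: "\<And>q. q \<in> chart_dom M i \<Longrightarrow> grad M i F q = 0"
  shows "hessian i F p u v = 0" and "laplacian M i F p = 0"
proof -
  have dF: "dirderiv M i F q w = 0" if "q \<in> chart_dom M i" for q w
    using metric_grad[OF that smooth_fun_differentiable(1)[OF F that], of w] g[OF that] that
    by (simp add: metric_linear)
  have "has_dirderiv M i (\<lambda>q. dirderiv M i F q v) p (\<lambda>_. 0)"
    by (rule has_dirderiv_cong[OF has_dirderiv_const open_chart_dom p p]) (simp add: dF)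
  from dirderiv_eq[OF this] show "hessian i F p u v = 0"
    by (simp add: hessian_def dF p)
  have "has_dirderiv M i (grad M i F) p (\<lambda>_. 0)"
    by (rule has_dirderiv_cong[OF has_dirderiv_const open_chart_dom p p]) (simp add: g)
  from dirderiv_eq[OF this] show "laplacian M i F p = 0"
    using p by (simp add: laplacian_def divergence_def nabla_def g)
qed

end

section \<open>Warped products\<close>

locale warped = M: riemannian M + N: riemannian N
  for M :: "('i, 'm::{t2_space,second_countable_topology}, 'e::euclidean_space) riem"
    and N :: "('j, 'n::{t2_space,second_countable_topology}, 'a::euclidean_space) riem" +
  fixes lam :: "'m \<Rightarrow> real"
  assumes lam_smooth: "smooth_fun M lam" and lam_pos: "lam x > 0"
begin

abbreviation P where "P \<equiv> warped_product M lam N"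

abbreviation warp :: "'m \<Rightarrow> real" where "warp \<equiv> \<lambda>x. (lam x)\<^sup>2"

lemma warp_pos [simp]: "warp x > 0" "lam x \<noteq> 0"
  using lam_pos[of x] by simp_all

lemmas lam_differentiable = M.smooth_fun_differentiable[OF lam_smooth]

lemma has_dirderiv_warp:
  assumes x: "x \<in> chart_dom M i"
  shows "has_dirderiv M i warp x (\<lambda>u. 2 * lam x * dirderiv M i lam x u)"
  using has_dirderiv_scaleR[OF has_dirderivI has_dirderivI, OF lam_differentiable(1)[OF x] lam_differentiable(1)[OF x]] x
  by (simp add: power2_eq_square mult_ac)

lemma warp_twice_differentiable: "twice_differentiable M i (chart_dom M i) warp"
  unfolding twice_differentiable_def
proof (intro ballI conjI allI)
  fix x u assume x: "x \<in> chart_dom M i"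
  show "dir_differentiable M i warp x"
    by (rule has_dirderiv_imp[OF has_dirderiv_warp[OF x]])
  have "dir_differentiable M i (\<lambda>y. lam y *\<^sub>R (2 * dirderiv M i lam y u)) x"
    using M.dir_differentiable_intros(3)[OF lam_differentiable(1)[OF x]
      has_dirderiv_imp[OF has_dirderiv_bounded_linear[OF bounded_linear_mult_right has_dirderivI[OF lam_differentiable(2)[OF x]]]]]
    by blast
  then show "dir_differentiable M i (\<lambda>y. dirderiv M i warp y u) x"
    by (rule M.dir_differentiable_cong[OF _ M.open_chart_dom x x])
      (simp add: dirderiv_eq[OF has_dirderiv_warp])
qed

lemma warp_differentiable:
  assumes "x \<in> chart_dom M i"
  shows "dir_differentiable M i warp x" "dir_differentiable M i (\<lambda>y. dirderiv M i warp y u) x"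
  using warp_twice_differentiable[of i] assms by (auto simp: twice_differentiable_def)

section \<open>Charts, connection and curvature of the warped product\<close>

lemma chart_dom_P [simp]: "chart_dom P (i, j) = chart_dom M i \<times> chart_dom N j"
  by (simp add: warped_product_def)

lemma coord_P [simp]: "coord P (i, j) (x, y) = (coord M i x, coord N j y)"
  by (simp add: warped_product_def)

lemma metric_P [simp]:
  "metric P (i, j) (x, y) (u, v) (u', v') = metric M i x u u' + warp x * metric N j y v v'"
  by (simp add: warped_product_def)

lemma chart_inv_P [simp]:
  assumes "x \<in> chart_dom M i" "y \<in> chart_dom N j"
  shows "chart_inv P (i, j) (coord M i x, coord N j y) = (x, y)"
  unfolding chart_inv_def
proof (rule inv_into_f_eq)
  show "inj_on (coord P (i, j)) (chart_dom P (i, j))"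
    by (auto simp: inj_on_def) (metis M.chart_inv_coord, metis N.chart_inv_coord)
qed (use assms in auto)

lemma open_coord_P: "open (coord M i ` chart_dom M i \<times> coord N j ` chart_dom N j)"
  by (intro open_Times M.open_coord_image N.open_coord_image M.open_chart_dom N.open_chart_dom order_refl)

lemma has_dirderiv_P_cong:
  assumes F: "has_dirderiv P (i, j) F (x, y) D" and p: "x \<in> chart_dom M i" "y \<in> chart_dom N j"
    and FG: "\<And>x y. x \<in> chart_dom M i \<Longrightarrow> y \<in> chart_dom N j \<Longrightarrow> F (x, y) = G (x, y)"
  shows "has_dirderiv P (i, j) G (x, y) D"
  unfolding has_dirderiv_def
  by (rule has_derivative_transform_within_open[OF F[unfolded has_dirderiv_def] open_coord_P])
    (use p in \<open>auto simp: FG\<close>)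

lemma has_dirderiv_P_fst:
  assumes F: "has_dirderiv M i F x D" and p: "x \<in> chart_dom M i" "y \<in> chart_dom N j"
  shows "has_dirderiv P (i, j) (\<lambda>z. F (fst z)) (x, y) (\<lambda>w. D (fst w))"
  unfolding has_dirderiv_def
proof (rule has_derivative_transform_within_open[OF _ open_coord_P])
  show "((\<lambda>w. (F \<circ> chart_inv M i) (fst w)) has_derivative (\<lambda>w. D (fst w))) (at (coord P (i, j) (x, y)))"
    by (rule has_derivative_compose[OF has_derivative_fst[OF has_derivative_ident]])
      (use F in \<open>simp add: has_dirderiv_def o_def\<close>)
qed (use p in auto)

lemma has_dirderiv_P_snd:
  assumes F: "has_dirderiv N j F y D" and p: "x \<in> chart_dom M i" "y \<in> chart_dom N j"
  shows "has_dirderiv P (i, j) (\<lambda>z. F (snd z)) (x, y) (\<lambda>w. D (snd w))"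
  unfolding has_dirderiv_def
proof (rule has_derivative_transform_within_open[OF _ open_coord_P])
  show "((\<lambda>w. (F \<circ> chart_inv N j) (snd w)) has_derivative (\<lambda>w. D (snd w))) (at (coord P (i, j) (x, y)))"
    by (rule has_derivative_compose[OF has_derivative_snd[OF has_derivative_ident]])
      (use F in \<open>simp add: has_dirderiv_def o_def\<close>)
qed (use p in auto)

lemma has_dirderiv_P_scaleR:
  assumes "has_dirderiv P (i, j) F (x, y) D" "has_dirderiv P (i, j) G (x, y) E"
    and "x \<in> chart_dom M i" "y \<in> chart_dom N j"
  shows "has_dirderiv P (i, j) (\<lambda>z. F z *\<^sub>R G z) (x, y) (\<lambda>u. D u *\<^sub>R G (x, y) + F (x, y) *\<^sub>R E u)"
  using has_dirderiv_scaleR[OF assms(1,2)] assms(3,4) by simp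

lemma dirderiv_metric_P:
  assumes p: "x \<in> chart_dom M i" "y \<in> chart_dom N j"
  shows "dirderiv P (i, j) (\<lambda>q. metric P (i, j) q (U, u) (V, v)) (x, y) (Z, z) =
    dirderiv M i (\<lambda>q. metric M i q U V) x Z + dirderiv M i warp x Z * metric N j y u v
      + warp x * dirderiv N j (\<lambda>q. metric N j q u v) y z"
proof -
  have eq: "(\<lambda>q. metric P (i, j) q (U, u) (V, v)) =
      (\<lambda>q. metric M i (fst q) U V + warp (fst q) *\<^sub>R metric N j (snd q) u v)"
    by (simp add: fun_eq_iff)
  have m: "has_dirderiv M i (\<lambda>q. metric M i q U V) x (dirderiv M i (\<lambda>q. metric M i q U V) x)"
    by (intro has_dirderivI M.metric_differentiable(1) p)
  have n: "has_dirderiv N j (\<lambda>q. metric N j q u v) y (dirderiv N j (\<lambda>q. metric N j q u v) y)"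
    by (intro has_dirderivI N.metric_differentiable(1) p)
  have w: "has_dirderiv M i warp x (dirderiv M i warp x)"
    by (intro has_dirderivI warp_differentiable(1) p)
  show ?thesis
    unfolding eq
    using dirderiv_eq[OF has_dirderiv_add[OF has_dirderiv_P_fst[OF m p]
      has_dirderiv_P_scaleR[OF has_dirderiv_P_fst[OF w p] has_dirderiv_P_snd[OF n p] p]], of "(Z, z)"]
    by simp
qed

text \<open>The classical connection of a warped product, verified by testing the Koszul identity
  against (Z, z). The only coupling of the factors is the derivative of \<open>warp\<close>: along Z
  it gives the gradient term, along U and V it gives the N-terms, where \<open>2 * warp x\<close>
  arises from dividing by the weight of the N-block.\<close>

lemma christoffel_P:
  assumes p: "x \<in> chart_dom M i" "y \<in> chart_dom N j"
  shows "christoffel P (i, j) (x, y) (U, u) (V, v) =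
    (christoffel M i x U V - (metric N j y u v / 2) *\<^sub>R grad M i warp x,
     christoffel N j y u v + (dirderiv M i warp x U / (2 * warp x)) *\<^sub>R v
       + (dirderiv M i warp x V / (2 * warp x)) *\<^sub>R u)"
  unfolding christoffel_def[of P]
proof (rule riesz_eqI)
  show "bilinear (metric P (i, j) (x, y))"
    unfolding bilinear_def
    by (intro conjI allI linearI)
      (auto simp: M.metric_linear[OF p(1)] N.metric_linear[OF p(2)] algebra_simps)
next
  fix w :: "'e \<times> 'a" assume "w \<noteq> 0"
  obtain Z z where w: "w = (Z, z)" by (cases w)
  have g: "metric M i x Z Z \<ge> 0" "Z \<noteq> 0 \<Longrightarrow> metric M i x Z Z > 0"
    using M.metric_pos[OF p(1), of Z] M.metric_linear[OF p(1)] by (cases "Z = 0"; simp)+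
  have h: "metric N j y z z \<ge> 0" "z \<noteq> 0 \<Longrightarrow> metric N j y z z > 0"
    using N.metric_pos[OF p(2), of z] N.metric_linear[OF p(2)] by (cases "z = 0"; simp)+
  have "Z \<noteq> 0 \<or> z \<noteq> 0" using \<open>w \<noteq> 0\<close> by (auto simp: w zero_prod_def)
  then show "metric P (i, j) (x, y) w w > 0"
    using g h by (auto simp: w intro: add_pos_nonneg add_nonneg_pos)
next
  fix w :: "'e \<times> 'a"
  obtain Z z where w: "w = (Z, z)" by (cases w)
  show "metric P (i, j) (x, y)
     (christoffel M i x U V - (metric N j y u v / 2) *\<^sub>R grad M i warp x,
      christoffel N j y u v + (dirderiv M i warp x U / (2 * warp x)) *\<^sub>R v
        + (dirderiv M i warp x V / (2 * warp x)) *\<^sub>R u) w =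
    (dirderiv P (i, j) (\<lambda>q. metric P (i, j) q (V, v) w) (x, y) (U, u) +
      dirderiv P (i, j) (\<lambda>q. metric P (i, j) q (U, u) w) (x, y) (V, v) -
      dirderiv P (i, j) (\<lambda>q. metric P (i, j) q (U, u) (V, v)) (x, y) w) / 2"
    unfolding w dirderiv_metric_P[OF p] metric_P M.metric_linear[OF p(1)] N.metric_linear[OF p(2)]
      M.koszul[OF p(1)] N.koszul[OF p(2)] M.metric_grad[OF p(1) warp_differentiable(1)[OF p(1)]]
    using N.metric_commute[OF p(2), of u v] warp_pos[of x]
    by (simp add: field_simps)
qed

text \<open>Exactly the components that occur in the f-bitension: the tension field points in the
  M-direction, the differential of the inclusion in the N-direction. The N-components of the two
  iterated derivatives agree and cancel.\<close>

lemma curvature_P: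
  assumes p: "x \<in> chart_dom M i" "y \<in> chart_dom N j"
  shows "curvature P (i, j) (x, y) (c, 0) (0, v) (0, w) =
    (metric N j y v w *\<^sub>R ((dirderiv M i warp x c / (4 * warp x)) *\<^sub>R grad M i warp x
       - (1 / 2) *\<^sub>R nabla M i (\<lambda>_. c) (grad M i warp) x), 0)"
proof -
  let ?k = "(i, j)" and ?G = "grad M i warp"
  define m where "m x = dirderiv M i warp x c / (2 * warp x)" for x
  have dG: "has_dirderiv M i ?G x (dirderiv M i ?G x)"
    by (intro has_dirderivI M.grad_differentiable warp_twice_differentiable p)
  have "(\<lambda>a. dirderiv M i warp (chart_inv M i a) c) differentiable (at (coord M i x))"
    "(\<lambda>a. warp (chart_inv M i a)) differentiable (at (coord M i x))"
    using warp_differentiable[OF p(1)] unfolding dir_differentiable_def o_def by blast+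
  from differentiable_divide[OF this(1) differentiable_mult[OF differentiable_const[of 2] this(2)]]
  have "(m \<circ> chart_inv M i) differentiable (at (coord M i x))"
    unfolding o_def m_def using warp_pos(2) by simp
  then have dm: "has_dirderiv M i m x (dirderiv M i m x)"
    by (intro has_dirderivI) (simp only: dir_differentiable_def)
  have dh: "has_dirderiv N j (\<lambda>q. metric N j q v w) y (dirderiv N j (\<lambda>q. metric N j q v w) y)"
    by (intro has_dirderivI N.metric_differentiable(1) p)
  have dC: "has_dirderiv N j (\<lambda>q. christoffel N j q v w) y (dirderiv N j (\<lambda>q. christoffel N j q v w) y)"
    by (intro has_dirderivI N.christoffel_differentiable p)
  have d0: "dirderiv M i warp q 0 = 0" if "q \<in> chart_dom M i" for q
    by (rule M.dirderiv_linear(3)[OF warp_differentiable(1)[OF that]])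
  \<comment> \<open>These inner derivatives are differentiated once more, so \<open>E1\<close> and
    \<open>E2\<close> are stated on the whole product chart.\<close>
  have E1: "nabla P ?k (\<lambda>_. (0, v)) (\<lambda>_. (0, w)) (x, y)
      = ((- (1 / 2) * metric N j y v w) *\<^sub>R ?G x, christoffel N j y v w)"
    if "x \<in> chart_dom M i" "y \<in> chart_dom N j" for x y
    using that by (simp add: nabla_def christoffel_P d0)
  have E2: "nabla P ?k (\<lambda>_. (c, 0)) (\<lambda>_. (0, w)) (x, y) = (0, m x *\<^sub>R w)"
    if "x \<in> chart_dom M i" "y \<in> chart_dom N j" for x y
    using that by (simp add: nabla_def christoffel_P d0 m_def N.metric_linear)
  have "has_dirderiv P ?k (\<lambda>z. ((- (1 / 2) * metric N j (snd z) v w) *\<^sub>R ?G (fst z), christoffel N j (snd z) v w)) (x, y)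
    (\<lambda>h. ((- (1 / 2) * dirderiv N j (\<lambda>q. metric N j q v w) y (snd h)) *\<^sub>R ?G x
       + (- (1 / 2) * metric N j y v w) *\<^sub>R dirderiv M i ?G x (fst h),
       dirderiv N j (\<lambda>q. christoffel N j q v w) y (snd h)))"
    using has_dirderiv_Pair[OF has_dirderiv_P_scaleR[OF
        has_dirderiv_bounded_linear[OF bounded_linear_mult_right[of "- (1/2)"] has_dirderiv_P_snd[OF dh p]]
        has_dirderiv_P_fst[OF dG p] p] has_dirderiv_P_snd[OF dC p]]
    by simp
  then have "has_dirderiv P ?k (nabla P ?k (\<lambda>_. (0, v)) (\<lambda>_. (0, w))) (x, y)
    (\<lambda>h. ((- (1 / 2) * dirderiv N j (\<lambda>q. metric N j q v w) y (snd h)) *\<^sub>R ?G x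
       + (- (1 / 2) * metric N j y v w) *\<^sub>R dirderiv M i ?G x (fst h),
       dirderiv N j (\<lambda>q. christoffel N j q v w) y (snd h)))"
    by (rule has_dirderiv_P_cong[OF _ p]) (simp add: E1)
  note D1 = dirderiv_eq[OF this, of "(c, 0)"]
  have "has_dirderiv P ?k (\<lambda>z. (0, m (fst z) *\<^sub>R w)) (x, y) (\<lambda>h. (0, dirderiv M i m x (fst h) *\<^sub>R w + m x *\<^sub>R 0))"
    using has_dirderiv_Pair[OF has_dirderiv_const has_dirderiv_P_scaleR[OF
        has_dirderiv_P_fst[OF dm p] has_dirderiv_const p]]
    by simp
  then have "has_dirderiv P ?k (nabla P ?k (\<lambda>_. (c, 0)) (\<lambda>_. (0, w))) (x, y)
      (\<lambda>h. (0, dirderiv M i m x (fst h) *\<^sub>R w + m x *\<^sub>R 0))"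
    by (rule has_dirderiv_P_cong[OF _ p]) (simp add: E2)
  note D2 = dirderiv_eq[OF this, of "(0, v)"]
  have lin0: "dirderiv N j (\<lambda>q. metric N j q v w) y 0 = 0"
    "dirderiv N j (\<lambda>q. christoffel N j q v w) y 0 = 0" "dirderiv M i m x 0 = 0"
    by (rule linear_0[OF has_dirderiv_linear[OF dh]] linear_0[OF has_dirderiv_linear[OF dC]]
        linear_0[OF has_dirderiv_linear[OF dm]])+
  have "curvature P ?k (x, y) (c, 0) (0, v) (0, w) =
      nabla P ?k (\<lambda>_. (c, 0)) (nabla P ?k (\<lambda>_. (0, v)) (\<lambda>_. (0, w))) (x, y)
      - nabla P ?k (\<lambda>_. (0, v)) (nabla P ?k (\<lambda>_. (c, 0)) (\<lambda>_. (0, w))) (x, y)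
      - nabla P ?k (\<lambda>_. (0, 0)) (\<lambda>_. (0, w)) (x, y)"
    by (simp add: curvature_def curvature_field_def lie_bracket_def[abs_def] zero_prod_def)
  also have "nabla P ?k (\<lambda>_. (0, 0)) (\<lambda>_. (0, w)) (x, y) = 0"
    using p by (simp add: nabla_def christoffel_P d0 N.metric_linear zero_prod_def)
  also have "nabla P ?k (\<lambda>_. (c, 0)) (nabla P ?k (\<lambda>_. (0, v)) (\<lambda>_. (0, w))) (x, y)
      = ((- (1 / 2) * metric N j y v w) *\<^sub>R nabla M i (\<lambda>_. c) ?G x, m x *\<^sub>R christoffel N j y v w)"
    using p
    by (simp add: nabla_def[of P ?k "\<lambda>_. (c, 0)"] D1 E1 christoffel_P d0 lin0 m_def
        M.christoffel_scaleR_right[OF p(1)] M.christoffel_scaleR_right[OF p(1), of c "-1", simplified]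
        N.metric_linear nabla_def[of M] scaleR_right_distrib)
  also have "nabla P ?k (\<lambda>_. (0, v)) (nabla P ?k (\<lambda>_. (c, 0)) (\<lambda>_. (0, w))) (x, y)
      = ((- (1 / 2) * m x * metric N j y v w) *\<^sub>R ?G x, m x *\<^sub>R christoffel N j y v w)"
    using p
    by (simp add: nabla_def[of P ?k "\<lambda>_. (0, v)"] D2 E2 christoffel_P d0 lin0
        N.christoffel_scaleR_right[OF p(2)] N.metric_linear)
  finally show ?thesis
    by (simp add: m_def scaleR_diff_right mult_ac)
qed

section \<open>The inclusion in coordinates, with chart j on the source and (i, j') on the
  target\<close>

context
  fixes x :: 'm and i :: 'i and j j' :: 'j
  assumes x: "x \<in> chart_dom M i"
begin

abbreviation transition where "transition \<equiv> dirderiv N j (coord N j')"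

lemma differential_inclusion:
  assumes y: "y \<in> chart_dom N j" "y \<in> chart_dom N j'"
  shows "differential N P j (i, j') (Pair x) y u = (0, transition y u)"
proof -
  have "coord P (i, j') \<circ> Pair x = (\<lambda>q. (coord M i x, coord N j' q))"
    by (simp add: fun_eq_iff)
  then show ?thesis
    unfolding differential_def
    using dirderiv_eq[OF has_dirderiv_Pair[OF has_dirderiv_const has_dirderivI[OF N.coord_differentiable(1)[OF y]]]]
    by simp
qed

lemma has_dirderiv_transition:
  assumes y: "y \<in> chart_dom N j" "y \<in> chart_dom N j'"
  shows "has_dirderiv N j (\<lambda>q. transition q v) y (dirderiv N j (\<lambda>q. transition q v) y)"
  by (rule has_dirderivI[OF N.coord_differentiable(2)[OF y]])

lemma warp_dirderiv_zero: "dirderiv M i warp x 0 = 0"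
  by (rule M.dirderiv_linear(3)[OF warp_differentiable(1)[OF x]])

text \<open>The N-component is the difference of the two sides of
  \<open>christoffel_change_chart\<close>. In the M-component, the isometry property of the
  transition map restores the metric in the chart j.\<close>

lemma second_fundamental_form_inclusion:
  assumes y: "y \<in> chart_dom N j" "y \<in> chart_dom N j'"
  shows "second_fundamental_form N P j (i, j') (Pair x) (\<lambda>_. u) (\<lambda>_. v) y
    = (metric N j y u v *\<^sub>R (- (1 / 2) *\<^sub>R grad M i warp x), 0)"
proof -
  have "has_dirderiv N j (\<lambda>q. differential N P j (i, j') (Pair x) q v) y
      (\<lambda>h. (0, dirderiv N j (\<lambda>q. transition q v) y h))"
    by (rule N.has_dirderiv_cong[OF has_dirderiv_Pair[OF has_dirderiv_const has_dirderiv_transition[OF y]]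
          N.open_chart_dom y(2) y(1)]) (simp add: differential_inclusion)
  note D = dirderiv_eq[OF this, of u]
  show ?thesis
    unfolding second_fundamental_form_def pullback_nabla_def D
    using x y
    by (simp add: differential_inclusion christoffel_P warp_dirderiv_zero nabla_def
        N.metric_change_chart[OF y, symmetric] N.christoffel_change_chart[OF y, symmetric] add_ac)
qed

lemma tension_inclusion:
  assumes y: "y \<in> chart_dom N j" "y \<in> chart_dom N j'"
  shows "tension N P j (i, j') (Pair x) y = (- (real DIM('a) / 2) *\<^sub>R grad M i warp x, 0)"
  unfolding tension_def second_fundamental_form_inclusion[OF y] metric_trace_Pair
    metric_trace_scaleR_left N.metric_trace_metric[OF y(1)]
  by (simp add: metric_trace_def)

context
  fixes f :: "'n \<Rightarrow> real"
  assumes f: "smooth_fun N f"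
begin

lemmas f_differentiable = N.smooth_fun_differentiable[OF f]

text \<open>The pull-back derivative of the constant field (c, 0) along X is \<open>mu c\<close>
  times the image of X under the differential. For c = - (n/2) G(x) it is the number mu of the
  overview.\<close>

definition mu :: "'e \<Rightarrow> real" where "mu c = dirderiv M i warp x c / (2 * warp x)"

text \<open>V is prescribed only on the overlap of the two charts of N, because the tension field is
  known only there.\<close>

lemma pullback_nabla_inclusion:
  assumes y: "y \<in> chart_dom N j" "y \<in> chart_dom N j'"
    and V: "\<And>q. q \<in> chart_dom N j \<Longrightarrow> q \<in> chart_dom N j' \<Longrightarrow> V q = (f q *\<^sub>R c, 0)"
  shows "pullback_nabla N P j (i, j') (Pair x) X V y
    = (dirderiv N j f y (X y) *\<^sub>R c, (f y * mu c) *\<^sub>R transition y (X y))"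
proof -
  have "has_dirderiv N j (\<lambda>q. (f q *\<^sub>R c, 0 :: 'a)) y (\<lambda>h. (dirderiv N j f y h *\<^sub>R c, 0))"
    by (intro has_dirderiv_Pair has_dirderiv_const
        has_dirderiv_bounded_linear[OF bounded_linear_scaleR_left] has_dirderivI f_differentiable y)
  then have "has_dirderiv N j V y (\<lambda>h. (dirderiv N j f y h *\<^sub>R c, 0))"
    by (rule N.has_dirderiv_cong[OF _ N.open_chart_dom y(2) y(1)]) (simp add: V)
  from dirderiv_eq[OF this, of "X y"] show ?thesis
    using x y M.dirderiv_linear(2)[OF warp_differentiable(1)[OF x], of "f y" c]
    by (simp add: pullback_nabla_def V differential_inclusion christoffel_P warp_dirderiv_zero
        N.metric_linear mu_def)
qed

text \<open>In the N-direction the derivative of the transition map and the Christoffel term combine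
  to the transition of \<open>christoffel N j y u v\<close>, which the correction along nabla_X Y
  removes. The same correction turns the second derivative of f into the Hessian.\<close>

lemma second_covariant_derivative_inclusion:
  assumes y: "y \<in> chart_dom N j" "y \<in> chart_dom N j'"
    and V: "\<And>q. q \<in> chart_dom N j \<Longrightarrow> q \<in> chart_dom N j' \<Longrightarrow> V q = (f q *\<^sub>R c, 0)"
  shows "second_covariant_derivative N P j (i, j') (Pair x) (\<lambda>_. u) (\<lambda>_. v) V y
    = (N.hessian j f y u v *\<^sub>R c + metric N j y u v *\<^sub>R (- (f y * mu c / 2) *\<^sub>R grad M i warp x),
       mu c *\<^sub>R (dirderiv N j f y u *\<^sub>R transition y v + dirderiv N j f y v *\<^sub>R transition y u))"
proof -
  have df: "has_dirderiv N j f y (dirderiv N j f y)"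
    and ddf: "has_dirderiv N j (\<lambda>q. dirderiv N j f q v) y (dirderiv N j (\<lambda>q. dirderiv N j f q v) y)"
    by (intro has_dirderivI f_differentiable y)+
  note pn = pullback_nabla_inclusion[OF _ _ V]
  have "has_dirderiv N j (\<lambda>q. (dirderiv N j f q v *\<^sub>R c, (f q * mu c) *\<^sub>R transition q v)) y
    (\<lambda>h. (dirderiv N j (\<lambda>q. dirderiv N j f q v) y h *\<^sub>R c,
       (dirderiv N j f y h * mu c) *\<^sub>R transition y v + (f y * mu c) *\<^sub>R dirderiv N j (\<lambda>q. transition q v) y h))"
    using has_dirderiv_Pair[OF has_dirderiv_bounded_linear[OF bounded_linear_scaleR_left ddf, of c]
        has_dirderiv_scaleR[OF has_dirderiv_bounded_linear[OF bounded_linear_mult_left df, of "mu c"]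
          has_dirderiv_transition[OF y, of v]]] y
    by simp
  then have "has_dirderiv N j (pullback_nabla N P j (i, j') (Pair x) (\<lambda>_. v) V) y
    (\<lambda>h. (dirderiv N j (\<lambda>q. dirderiv N j f q v) y h *\<^sub>R c,
       (dirderiv N j f y h * mu c) *\<^sub>R transition y v + (f y * mu c) *\<^sub>R dirderiv N j (\<lambda>q. transition q v) y h))"
    by (rule N.has_dirderiv_cong[OF _ N.open_chart_dom y(2) y(1)])
      (rule pn[symmetric])
  note D = dirderiv_eq[OF this, of u]
  have "pullback_nabla N P j (i, j') (Pair x) (\<lambda>_. u)
      (pullback_nabla N P j (i, j') (Pair x) (\<lambda>_. v) V) y
    = (dirderiv N j (\<lambda>q. dirderiv N j f q v) y u *\<^sub>R c
         + metric N j y u v *\<^sub>R (- (f y * mu c / 2) *\<^sub>R grad M i warp x),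
       (f y * mu c) *\<^sub>R transition y (christoffel N j y u v)
         + mu c *\<^sub>R (dirderiv N j f y u *\<^sub>R transition y v + dirderiv N j f y v *\<^sub>R transition y u))"
    unfolding pullback_nabla_def[of N P j "(i, j')" "Pair x" "\<lambda>_. u"] D
    using x y M.dirderiv_linear(2)[OF warp_differentiable(1)[OF x], of "dirderiv N j f y v" c]
    by (simp add: pn differential_inclusion christoffel_P warp_dirderiv_zero
        N.metric_linear N.christoffel_scaleR_right N.metric_change_chart[OF y]
        N.christoffel_change_chart[OF y, symmetric] mu_def algebra_simps)
  moreover have "pullback_nabla N P j (i, j') (Pair x) (nabla N j (\<lambda>_. u) (\<lambda>_. v)) V y
    = (dirderiv N j f y (christoffel N j y u v) *\<^sub>R c, (f y * mu c) *\<^sub>R transition y (christoffel N j y u v))"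
    by (simp add: pn y nabla_def)
  ultimately show ?thesis
    by (simp add: second_covariant_derivative_def N.hessian_def scaleR_diff_left)
qed

text \<open>In the M-direction the second covariant derivative contributes (n f mu / 2) G and the
  curvature contributes its negative. What survives is the Hessian term and (n f / 2) nabla_c G with
  c = - (n/2) G(x), which explains the constant \<open>n\<^sup>2 / 8\<close>.\<close>

lemma f_bitension_inclusion:
  assumes y: "y \<in> chart_dom N j" "y \<in> chart_dom N j'"
  defines "G \<equiv> grad M i warp" and "n \<equiv> real DIM('a)"
  shows "f_bitension N P j (i, j') f (Pair x) y =
    ((n / 2 * metric_trace (metric N j y) (N.hessian j f y)) *\<^sub>R G x
       - (n\<^sup>2 * f y / 8) *\<^sub>R grad M i (\<lambda>x. sqnorm M i x (G x)) x,
     (n * metric M i x (G x) (G x) / (2 * warp x)) *\<^sub>R transition y (grad N j f y))"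
proof -
  define c where "c = - (n / 2) *\<^sub>R G x"
  have G: "dir_differentiable M i G x"
    unfolding G_def by (rule M.grad_differentiable[OF warp_twice_differentiable x])
  have mu: "mu c = - (n / 2) * metric M i x (G x) (G x) / (2 * warp x)"
    using M.metric_grad[OF x warp_differentiable(1)[OF x], of c] x
    by (simp add: mu_def G_def c_def M.metric_linear)
  \<comment> \<open>A covariant derivative depends linearly on the value of its direction at x, so
    the constant extension of c may be exchanged for a multiple of G.\<close>
  have nab: "nabla M i (\<lambda>_. c) G x = - (n / 4) *\<^sub>R grad M i (\<lambda>x. sqnorm M i x (G x)) x"
  proof -
    have "nabla M i (\<lambda>_. c) G x = - (n / 2) *\<^sub>R nabla M i G G x"
      using M.dirderiv_linear(2)[OF G, of "- (n / 2)" "G x"]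
        M.christoffel_scaleR_right[OF x, of "G x" "- (n / 2)" "G x"] M.christoffel_commute[OF x, of "G x" c]
      by (simp add: nabla_def c_def scaleR_right_distrib)
    then show ?thesis
      using M.grad_sqnorm_grad[OF warp_twice_differentiable x] by (simp add: G_def)
  qed
  have tens: "tension N P j (i, j') (Pair x) q = (c, 0)"
    if "q \<in> chart_dom N j" "q \<in> chart_dom N j'" for q
    using tension_inclusion[OF that] by (simp add: c_def n_def G_def)
  have lin: "linear (transition y)" by (rule N.linear_dirderiv[OF N.coord_differentiable(1)[OF y]])
  have T1: "metric_trace (metric N j y) (\<lambda>u v. second_covariant_derivative N P j (i, j') (Pair x)
      (\<lambda>_. u) (\<lambda>_. v) (\<lambda>q. f q *\<^sub>R tension N P j (i, j') (Pair x) q) y)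
    = (metric_trace (metric N j y) (N.hessian j f y) *\<^sub>R c + n *\<^sub>R (- (f y * mu c / 2) *\<^sub>R G x),
       mu c *\<^sub>R (transition y (grad N j f y) + transition y (grad N j f y)))"
    by (simp only: second_covariant_derivative_inclusion[OF y, where c = c] tens scaleR_Pair scaleR_zero_right
        metric_trace_Pair metric_trace_add metric_trace_scaleR_left metric_trace_scaleR_right
        N.metric_trace_metric[OF y(1)] N.metric_trace_dirderiv[OF y(1) f_differentiable(1)[OF y(1)] lin]
        n_def G_def)
  have T2: "metric_trace (metric N j y) (\<lambda>u v. curvature P (i, j') (x, y) (tension N P j (i, j') (Pair x) y)
      (differential N P j (i, j') (Pair x) y u) (differential N P j (i, j') (Pair x) y v))
    = (n *\<^sub>R ((mu c / 2) *\<^sub>R G x - (1 / 2) *\<^sub>R nabla M i (\<lambda>_. c) G x), 0)"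
    by (simp only: differential_inclusion[OF y] tens[OF y] curvature_P[OF x y(2)]
        N.metric_change_chart[OF y, symmetric] metric_trace_Pair metric_trace_scaleR_left
        N.metric_trace_metric[OF y(1)] n_def G_def)
      (simp add: metric_trace_def mu_def)
  show ?thesis
    unfolding f_bitension_def T1 T2 nab
    by (simp add: c_def[symmetric] mu) (simp add: c_def algebra_simps power2_eq_square flip: scaleR_left_distrib)
qed

end

section \<open>Critical points of the warping function and the equivalence\<close>

lemma grad_warp: "grad M i warp x = (2 * lam x) *\<^sub>R grad M i lam x"
proof (rule M.metric_eqI[OF x])
  fix z
  show "metric M i x (grad M i warp x) z = metric M i x ((2 * lam x) *\<^sub>R grad M i lam x) z"
    using x by (simp add: M.metric_grad lam_differentiable warp_differentiable M.metric_linear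
        dirderiv_eq[OF has_dirderiv_warp])
qed

lemma grad_warp_eq_0_iff: "grad M i warp x = 0 \<longleftrightarrow> sqnorm M i x (grad M i lam x) = 0"
  using M.metric_pos[OF x, of "grad M i lam x"] warp_pos(2)[of x] x
  by (cases "grad M i lam x = 0") (auto simp: grad_warp sqnorm_def M.metric_linear)

text \<open>The gradient of |G|^2 is 2 nabla_G G, and this vanishes together with its direction
  G.\<close>

lemma critical_point_imp:
  assumes "grad M i warp x = 0"
  shows "grad M i (\<lambda>x. sqnorm M i x (grad M i warp x)) x = 0"
  using assms x M.dirderiv_linear(3)[OF M.grad_differentiable[OF warp_twice_differentiable x]]
  by (simp add: M.grad_sqnorm_grad[OF warp_twice_differentiable x] nabla_def)

end

text \<open>In charts the inclusion is a constant paired with a change of charts of N; if x is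
  outside the chart of M, the set in question is empty.\<close>

lemma smooth_map_inclusion: "smooth_map N P (Pair x)"
  unfolding smooth_map_def
proof (intro conjI allI)
  show "continuous_on UNIV (Pair x :: 'n \<Rightarrow> _)" by (intro continuous_intros)
  fix j and k :: "'i \<times> 'j"
  obtain i j' where k: "k = (i, j')" by (cases k)
  let ?U = "chart_dom N j \<inter> Pair x -` chart_dom P k"
  have "?U = (if x \<in> chart_dom M i then chart_dom N j \<inter> chart_dom N j' else {})"
    by (auto simp: k)
  moreover have "smooth_on (coord N j ` (chart_dom N j \<inter> chart_dom N j'))
      (\<lambda>a. (coord M i x, (coord N j' \<circ> chart_inv N j) a))"
    using N.smooth_manifold N.open_chart_dom
    by (intro smooth_on_Pair_const N.open_coord_image) (auto simp: smooth_manifold_def o_def)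
  moreover have "coord P k \<circ> Pair x \<circ> chart_inv N j = (\<lambda>a. (coord M i x, (coord N j' \<circ> chart_inv N j) a))"
    by (simp add: k fun_eq_iff)
  ultimately show "smooth_on (coord N j ` ?U) (coord P k \<circ> Pair x \<circ> chart_inv N j)"
    by (simp add: smooth_on_empty)
qed

theorem f_biharmonic_inclusion_iff:
  assumes f: "smooth_fun N f" "\<And>y. f y > 0"
  shows "f_biharmonic N P f (Pair x) \<longleftrightarrow>
    (\<forall>i j y. x \<in> chart_dom M i \<longrightarrow> y \<in> chart_dom N j \<longrightarrow>
       (real DIM('a) * f y) *\<^sub>R grad M i (\<lambda>x. sqnorm M i x (grad M i warp x)) x
         - (8 * laplacian N j f y) *\<^sub>R grad M i warp x = 0 \<and>
       sqnorm M i x (grad M i lam x) *\<^sub>R grad N j f y = 0)"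
    (is "_ \<longleftrightarrow> ?R")
proof
  assume bi: "f_biharmonic N P f (Pair x)"
  show ?R
  proof (intro allI impI)
    fix i j y assume x: "x \<in> chart_dom M i" and y: "y \<in> chart_dom N j"
    let ?S = "grad M i (\<lambda>x. sqnorm M i x (grad M i warp x)) x"
    \<comment> \<open>Using the same chart of N on both sides makes the transition map the identity,
      so the N-component is a multiple of grad f itself.\<close>
    have bitension_0: "f_bitension N P j (i, j) f (Pair x) q = 0" if "q \<in> chart_dom N j" for q
      using bi that x by (auto simp: f_biharmonic_def)
    show "(real DIM('a) * f y) *\<^sub>R ?S - (8 * laplacian N j f y) *\<^sub>R grad M i warp x = 0 \<and>
      sqnorm M i x (grad M i lam x) *\<^sub>R grad N j f y = 0"
    proof (cases "grad M i warp x = 0")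
      case True
      then show ?thesis
        using critical_point_imp[OF x] grad_warp_eq_0_iff[OF x] by simp
    next
      case False
      then have "metric M i x (grad M i warp x) (grad M i warp x) \<noteq> 0"
        using M.metric_pos[OF x, of "grad M i warp x"] by simp
      then have g: "grad N j f q = 0" if "q \<in> chart_dom N j" for q
        using bitension_0[OF that] f_bitension_inclusion[OF x f(1) that that]
          N.dirderiv_coord_self[OF that] warp_pos(2)[of x]
        by (simp add: zero_prod_def)
      \<comment> \<open>The Hessian vanishes because grad f = 0 throughout the chart, and the
        remaining coefficient \<open>n\<^sup>2 * f y / 8\<close> is positive.\<close>
      have "?S = 0"
        using bitension_0[OF y] f_bitension_inclusion[OF x f(1) y y] N.grad_zero_imp(1)[OF f(1) y g] f(2)[of y]
        by (simp add: zero_prod_def metric_trace_def)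
      then show ?thesis
        using g[OF y] N.grad_zero_imp(2)[OF f(1) y g] by simp
    qed
  qed
next
  assume R: ?R
  have "f_bitension N P j k f (Pair x) y = 0" if y: "y \<in> chart_dom N j" and k: "(x, y) \<in> chart_dom P k"
    for j and k :: "'i \<times> 'j" and y
  proof -
    \<comment> \<open>Here j' may differ from j, but the transition map is multiplied by zero or
      applied to grad f = 0.\<close>
    obtain i j' where ij: "k = (i, j')" by (cases k)
    have x: "x \<in> chart_dom M i" and y': "y \<in> chart_dom N j'" using k by (auto simp: ij)
    let ?S = "grad M i (\<lambda>x. sqnorm M i x (grad M i warp x)) x"
    show ?thesis
    proof (cases "grad M i warp x = 0")
      case True
      then show ?thesis
        using x critical_point_imp[OF x]
        by (simp add: ij f_bitension_inclusion[OF x f(1) y y'] zero_prod_def M.metric_linear)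
    next
      case False
      then have g: "grad N j f q = 0" if "q \<in> chart_dom N j" for q
        using R x that grad_warp_eq_0_iff[OF x] by auto
      have "?S = 0"
        using R x y f(2)[of y] N.grad_zero_imp(2)[OF f(1) y g] by fastforce
      then show ?thesis
        using N.dirderiv_linear(3)[OF N.coord_differentiable(1)[OF y y']]
        by (simp add: ij f_bitension_inclusion[OF x f(1) y y'] zero_prod_def metric_trace_def
            N.grad_zero_imp(1)[OF f(1) y g] g y)
    qed
  qed
  then show "f_biharmonic N P f (Pair x)"
    unfolding f_biharmonic_def using smooth_map_inclusion by blast
qed

end

theorem corollary6p2:
  fixes M :: "('i, 'm::{t2_space,second_countable_topology}, 'e::euclidean_space) riem"
    and N :: "('j, 'n::{t2_space,second_countable_topology}, 'a::euclidean_space) riem"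
    and lam :: "'m \<Rightarrow> real" and f :: "'n \<Rightarrow> real" and x0 :: 'm
  assumes "riemannian_manifold M" and "riemannian_manifold N"
    and "smooth_fun M lam" and "\<And>x. lam x > 0"
    and "smooth_fun N f" and "\<And>y. f y > 0"
  shows "f_biharmonic N (warped_product M lam N) f (\<lambda>y. (x0, y)) \<longleftrightarrow>
    (\<forall>i j y. x0 \<in> chart_dom M i \<longrightarrow> y \<in> chart_dom N j \<longrightarrow>
       (real DIM('a) * f y) *\<^sub>R
           grad M i (\<lambda>x. sqnorm M i x (grad M i (\<lambda>x. (lam x)\<^sup>2) x)) x0
         - (8 * laplacian N j f y) *\<^sub>R grad M i (\<lambda>x. (lam x)\<^sup>2) x0 = 0 \<and>
       sqnorm M i x0 (grad M i lam x0) *\<^sub>R grad N j f y = 0)"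
proof -
  interpret warped M N lam
    by unfold_locales (use assms in auto)
  show ?thesis by (rule f_biharmonic_inclusion_iff[OF assms(5,6)])
qed

end
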